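(* Over $\mathrm{HA}^\omega$, Spector's (restricted) bar recursion $\mathsf{SBR}$ is $T$-definable from the dependent explicitly controlled product of selection functions $\mathsf{EPS}$; that is, $\mathsf{EPS}\geq_T\mathsf{SBR}$.
   Context: Types and systems. Finite types are generated from $\mathbb{B}$ (booleans) and $\mathbb{N}$ by $X\times Y$, $X\to Y$ and $X^*$ (finite sequences). For a sequence of types $(X_i)_{i\in\mathbb{N}}$, $\Pi_i X_i$ is the type of infinite sequences whose $i$-th entry is in $X_i$ and $\Pi_{i<n}X_i$ the type of finite sequences of length $n$. (This is used for readability; one may take all $X_i$ equal to one type $X$, reading $\Pi_iX_i$ as $\mathbb{N}\to X$ and finite sequence types as $X^*$.) $\mathrm{HA}^\omega$ is Heyting arithmetic in all finite types with fully extensional equality (Troelstra's E-$\mathrm{HA}^\omega$); system $T$ is its quantifier-free fragment (Gödel's primitive recursive functionals). $\mathbf{0}$ denotes the canonical zero object of each type (the zero sequence for sequence types). Notation. $*$ is concatenation; $|s|$ is the length of $s$; $q_s(\alpha)=q(s*\alpha)$, $q_x=q_{\langle x\rangle}$. $J_RX=(X\to R)\to X$. For a finite sequence $s\colon\Pi_{i<|s|}X_i$ and $\alpha\colon\Pi_iX_i$, the overwriting $s\,@\,\alpha\colon\Pi_iX_i$ is $(s\,@\,\alpha)(i)=s_i$ if $i<|s|$ and $(s\,@\,\alpha)(i)=\alpha(i)$ otherwise. $T$-definability. A functional is specified by a defining equation (for each choice of type parameters). $G$ is $T$-definable from $F$ over a theory $\mathcal{S}$ (written $F\ge_T G$) if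 for each choice of types for $G$ there are a choice of types for $F$ and a term $s$ of system $T$ such that $s(F)$ satisfies the defining equation of $G$, provably in $\mathcal{S}$ together with the defining equation of $F$. $\mathsf{EPS}$. For $\varepsilon\colon\Pi_k(\Pi_{i<k}X_i\to J_RX_k)$ (so $\varepsilon_s\colon J_RX_{|s|}$ for a finite sequence $s\colon\Pi_{i<|s|}X_i$), $\ell\colon R\to\mathbb{N}$, $q\colon\Pi_iX_{|s|+i}\to R$, the value $\mathsf{EPS}^\ell_s(\varepsilon)(q)\colon\Pi_iX_{|s|+i}$ is specified by: $\mathsf{EPS}^\ell_s(\varepsilon)(q)=\mathbf{0}$ if $\ell(q(\mathbf{0}))<|s|$, and otherwise $\mathsf{EPS}^\ell_s(\varepsilon)(q)=c*\mathsf{EPS}^\ell_{s*c}(\varepsilon)(q_c)$, where $c=\varepsilon_s(\lambda x.\,q_x(\mathsf{EPS}^\ell_{s*x}(\varepsilon)(q_x)))$. $\mathsf{SBR}$. For $\varepsilon_s\colon J_{\Pi_iX_i}X_{|s|}$ (for each finite sequence $s$) and $\omega\colon\Pi_iX_i\to\mathbb{N}$, the value $\mathsf{SBR}^\omega_s(\varepsilon)\colon\Pi_iX_i$ is specified by: $\mathsf{SBR}^\omega_s(\varepsilon)=s\,@\,\mathbf{0}$ if $\omega_s(\mathbf{0})<|s|$, and otherwise $\mathsf{SBR}^\omega_s(\varepsilon)=s\,@\,\mathsf{SBR}^\omega_{s*c}(\varepsilon)$, where $c=\varepsilon_s(\lambda x^{X_{|s|}}.\,\mathsf{SBR}^\omega_{s*x}(\varepsilon))$.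 *)

theory Defs
  imports Main
begin

section \<open>Finite types and the terms of system T\<close>

datatype ty = Bool | Nat | Prod ty ty | Fun ty ty (infixr "\<rightarrow>" 65) | Seq ty

text \<open>Terms are de Bruijn terms, with Church-style annotations on abstractions and constants.\<close>

datatype const =
    True_c | False_c
  | If_c ty                \<comment> \<open>case distinction into the given type\<close>
  | Zero_c | Suc_c
  | Rec_c ty               \<comment> \<open>primitive recursion into the given type\<close>
  | Pair_c ty ty | Fst_c ty ty | Snd_c ty ty
  | Nil_c ty | Cons_c ty
  | SRec_c ty ty           \<comment> \<open>recursion over sequences of the first type into the second type\<close>

fun const_ty :: "const \<Rightarrow> ty" where
  "const_ty True_c = Bool"
| "const_ty False_c = Bool"
| "const_ty (If_c X) = Bool \<rightarrow> X \<rightarrow> X \<rightarrow> X"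
| "const_ty Zero_c = Nat"
| "const_ty Suc_c = Nat \<rightarrow> Nat"
| "const_ty (Rec_c X) = X \<rightarrow> (Nat \<rightarrow> X \<rightarrow> X) \<rightarrow> Nat \<rightarrow> X"
| "const_ty (Pair_c X Y) = X \<rightarrow> Y \<rightarrow> Prod X Y"
| "const_ty (Fst_c X Y) = Prod X Y \<rightarrow> X"
| "const_ty (Snd_c X Y) = Prod X Y \<rightarrow> Y"
| "const_ty (Nil_c X) = Seq X"
| "const_ty (Cons_c X) = X \<rightarrow> Seq X \<rightarrow> Seq X"
| "const_ty (SRec_c X Y) = Y \<rightarrow> (X \<rightarrow> Seq X \<rightarrow> Y \<rightarrow> Y) \<rightarrow> Seq X \<rightarrow> Y"

datatype tm = Var nat | Const const | Lam ty tm | App tm tm (infixl "\<cdot>" 200)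

text \<open>Position \<open>i\<close> of a context is the type of the variable with index \<open>i\<close>.\<close>

type_synonym ctx = "ty list"

inductive typing :: "ctx \<Rightarrow> tm \<Rightarrow> ty \<Rightarrow> bool" ("_ \<turnstile> _ : _" [50, 50, 50] 50) where
  Var: "i < length \<Gamma> \<Longrightarrow> \<Gamma> ! i = \<tau> \<Longrightarrow> \<Gamma> \<turnstile> Var i : \<tau>"
| Const: "const_ty c = \<tau> \<Longrightarrow> \<Gamma> \<turnstile> Const c : \<tau>"
| Lam: "\<sigma> # \<Gamma> \<turnstile> t : \<tau> \<Longrightarrow> \<Gamma> \<turnstile> Lam \<sigma> t : \<sigma> \<rightarrow> \<tau>"
| App: "\<Gamma> \<turnstile> t : \<sigma> \<rightarrow> \<tau> \<Longrightarrow> \<Gamma> \<turnstile> u : \<sigma> \<Longrightarrow> \<Gamma> \<turnstile> t \<cdot> u : \<tau>"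

primrec rename :: "(nat \<Rightarrow> nat) \<Rightarrow> tm \<Rightarrow> tm" where
  "rename \<rho> (Var i) = Var (\<rho> i)"
| "rename \<rho> (Const c) = Const c"
| "rename \<rho> (Lam \<sigma> t) = Lam \<sigma> (rename (case_nat 0 (\<lambda>i. Suc (\<rho> i))) t)"
| "rename \<rho> (t \<cdot> u) = rename \<rho> t \<cdot> rename \<rho> u"

abbreviation lift :: "tm \<Rightarrow> tm" where
  "lift \<equiv> rename Suc"

definition under :: "(nat \<Rightarrow> tm) \<Rightarrow> nat \<Rightarrow> tm" where
  "under \<theta> = case_nat (Var 0) (\<lambda>i. lift (\<theta> i))"

primrec subst :: "(nat \<Rightarrow> tm) \<Rightarrow> tm \<Rightarrow> tm" where
  "subst \<theta> (Var i) = \<theta> i"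
| "subst \<theta> (Const c) = Const c"
| "subst \<theta> (Lam \<sigma> t) = Lam \<sigma> (subst (under \<theta>) t)"
| "subst \<theta> (t \<cdot> u) = subst \<theta> t \<cdot> subst \<theta> u"

text \<open>\<open>inst u\<close> substitutes \<open>u\<close> for variable 0 and removes that variable from the context;
  \<open>repl n u\<close> substitutes \<open>u\<close> for variable 0, where \<open>u\<close> lives in a context that has \<open>n\<close> variables
  in place of variable 0.\<close>

definition inst :: "tm \<Rightarrow> nat \<Rightarrow> tm" where
  "inst u = case_nat u Var"

definition repl :: "nat \<Rightarrow> tm \<Rightarrow> nat \<Rightarrow> tm" where
  "repl n u = case_nat u (\<lambda>i. Var (n + i))"


section \<open>Many-sorted intuitionistic logic with equality\<close>

datatype fm =
    Eq ty tm tm | Falsum | Conj fm fm | Disj fm fm | Imp fm fm | All ty fm | Ex ty fm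

abbreviation Neg :: "fm \<Rightarrow> fm" where
  "Neg \<phi> \<equiv> Imp \<phi> Falsum"

primrec wff :: "ctx \<Rightarrow> fm \<Rightarrow> bool" where
  "wff \<Gamma> (Eq \<tau> t u) \<longleftrightarrow> \<Gamma> \<turnstile> t : \<tau> \<and> \<Gamma> \<turnstile> u : \<tau>"
| "wff \<Gamma> Falsum \<longleftrightarrow> True"
| "wff \<Gamma> (Conj \<phi> \<psi>) \<longleftrightarrow> wff \<Gamma> \<phi> \<and> wff \<Gamma> \<psi>"
| "wff \<Gamma> (Disj \<phi> \<psi>) \<longleftrightarrow> wff \<Gamma> \<phi> \<and> wff \<Gamma> \<psi>"
| "wff \<Gamma> (Imp \<phi> \<psi>) \<longleftrightarrow> wff \<Gamma> \<phi> \<and> wff \<Gamma> \<psi>"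
| "wff \<Gamma> (All \<tau> \<phi>) \<longleftrightarrow> wff (\<tau> # \<Gamma>) \<phi>"
| "wff \<Gamma> (Ex \<tau> \<phi>) \<longleftrightarrow> wff (\<tau> # \<Gamma>) \<phi>"

primrec fsubst :: "(nat \<Rightarrow> tm) \<Rightarrow> fm \<Rightarrow> fm" where
  "fsubst \<theta> (Eq \<tau> t u) = Eq \<tau> (subst \<theta> t) (subst \<theta> u)"
| "fsubst \<theta> Falsum = Falsum"
| "fsubst \<theta> (Conj \<phi> \<psi>) = Conj (fsubst \<theta> \<phi>) (fsubst \<theta> \<psi>)"
| "fsubst \<theta> (Disj \<phi> \<psi>) = Disj (fsubst \<theta> \<phi>) (fsubst \<theta> \<psi>)"
| "fsubst \<theta> (Imp \<phi> \<psi>) = Imp (fsubst \<theta> \<phi>) (fsubst \<theta> \<psi>)"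
| "fsubst \<theta> (All \<tau> \<phi>) = All \<tau> (fsubst (under \<theta>) \<phi>)"
| "fsubst \<theta> (Ex \<tau> \<phi>) = Ex \<tau> (fsubst (under \<theta>) \<phi>)"

abbreviation flift :: "fm \<Rightarrow> fm" where
  "flift \<equiv> fsubst (\<lambda>i. Var (Suc i))"

text \<open>A theory is given by its non-logical axioms, each of them a formula in a context of parameters.
  \<open>derives S \<Gamma> \<Phi> \<phi>\<close> is natural deduction of \<open>\<phi>\<close> from the assumptions \<open>\<Phi>\<close> over \<open>S\<close>, where \<open>\<phi>\<close> and \<open>\<Phi>\<close>
  have their free variables in \<open>\<Gamma>\<close>.\<close>

type_synonym axioms = "ctx \<Rightarrow> fm \<Rightarrow> bool"

inductive derives :: "axioms \<Rightarrow> ctx \<Rightarrow> fm list \<Rightarrow> fm \<Rightarrow> bool" for S :: axioms where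
  Ax: "S \<Gamma> \<phi> \<Longrightarrow> derives S \<Gamma> \<Phi> \<phi>"
| Hyp: "\<phi> \<in> set \<Phi> \<Longrightarrow> derives S \<Gamma> \<Phi> \<phi>"
| FalsumE: "derives S \<Gamma> \<Phi> Falsum \<Longrightarrow> wff \<Gamma> \<phi> \<Longrightarrow> derives S \<Gamma> \<Phi> \<phi>"
| ConjI: "derives S \<Gamma> \<Phi> \<phi> \<Longrightarrow> derives S \<Gamma> \<Phi> \<psi> \<Longrightarrow> derives S \<Gamma> \<Phi> (Conj \<phi> \<psi>)"
| ConjE1: "derives S \<Gamma> \<Phi> (Conj \<phi> \<psi>) \<Longrightarrow> derives S \<Gamma> \<Phi> \<phi>"
| ConjE2: "derives S \<Gamma> \<Phi> (Conj \<phi> \<psi>) \<Longrightarrow> derives S \<Gamma> \<Phi> \<psi>"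
| DisjI1: "derives S \<Gamma> \<Phi> \<phi> \<Longrightarrow> wff \<Gamma> \<psi> \<Longrightarrow> derives S \<Gamma> \<Phi> (Disj \<phi> \<psi>)"
| DisjI2: "derives S \<Gamma> \<Phi> \<psi> \<Longrightarrow> wff \<Gamma> \<phi> \<Longrightarrow> derives S \<Gamma> \<Phi> (Disj \<phi> \<psi>)"
| DisjE: "derives S \<Gamma> \<Phi> (Disj \<phi> \<psi>) \<Longrightarrow> derives S \<Gamma> (\<phi> # \<Phi>) \<chi> \<Longrightarrow> derives S \<Gamma> (\<psi> # \<Phi>) \<chi> \<Longrightarrow>
    derives S \<Gamma> \<Phi> \<chi>"
| ImpI: "wff \<Gamma> \<phi> \<Longrightarrow> derives S \<Gamma> (\<phi> # \<Phi>) \<psi> \<Longrightarrow> derives S \<Gamma> \<Phi> (Imp \<phi> \<psi>)"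
| ImpE: "derives S \<Gamma> \<Phi> (Imp \<phi> \<psi>) \<Longrightarrow> derives S \<Gamma> \<Phi> \<phi> \<Longrightarrow> derives S \<Gamma> \<Phi> \<psi>"
| AllI: "derives S (\<tau> # \<Gamma>) (map flift \<Phi>) \<phi> \<Longrightarrow> derives S \<Gamma> \<Phi> (All \<tau> \<phi>)"
| AllE: "derives S \<Gamma> \<Phi> (All \<tau> \<phi>) \<Longrightarrow> \<Gamma> \<turnstile> t : \<tau> \<Longrightarrow> derives S \<Gamma> \<Phi> (fsubst (inst t) \<phi>)"
| ExI: "wff (\<tau> # \<Gamma>) \<phi> \<Longrightarrow> \<Gamma> \<turnstile> t : \<tau> \<Longrightarrow> derives S \<Gamma> \<Phi> (fsubst (inst t) \<phi>) \<Longrightarrow>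
    derives S \<Gamma> \<Phi> (Ex \<tau> \<phi>)"
| ExE: "derives S \<Gamma> \<Phi> (Ex \<tau> \<phi>) \<Longrightarrow> wff \<Gamma> \<chi> \<Longrightarrow>
    derives S (\<tau> # \<Gamma>) (\<phi> # map flift \<Phi>) (flift \<chi>) \<Longrightarrow> derives S \<Gamma> \<Phi> \<chi>"
| EqI: "\<Gamma> \<turnstile> t : \<tau> \<Longrightarrow> derives S \<Gamma> \<Phi> (Eq \<tau> t t)"
| EqE: "derives S \<Gamma> \<Phi> (Eq \<tau> t u) \<Longrightarrow> wff (\<tau> # \<Gamma>) \<phi> \<Longrightarrow> derives S \<Gamma> \<Phi> (fsubst (inst t) \<phi>) \<Longrightarrow>
    derives S \<Gamma> \<Phi> (fsubst (inst u) \<phi>)"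


section \<open>Extensional Heyting arithmetic in all finite types\<close>

abbreviation "tt \<equiv> Const True_c"
abbreviation "ff \<equiv> Const False_c"
abbreviation "if_tm X b t u \<equiv> Const (If_c X) \<cdot> b \<cdot> t \<cdot> u"
abbreviation "zero_tm \<equiv> Const Zero_c"
abbreviation "suc_tm n \<equiv> Const Suc_c \<cdot> n"
abbreviation "nrec_tm X a f n \<equiv> Const (Rec_c X) \<cdot> a \<cdot> f \<cdot> n"
abbreviation "pair_tm X Y a b \<equiv> Const (Pair_c X Y) \<cdot> a \<cdot> b"
abbreviation "fst_tm X Y p \<equiv> Const (Fst_c X Y) \<cdot> p"
abbreviation "snd_tm X Y p \<equiv> Const (Snd_c X Y) \<cdot> p"
abbreviation "nil_tm X \<equiv> Const (Nil_c X)"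
abbreviation "cons_tm X a s \<equiv> Const (Cons_c X) \<cdot> a \<cdot> s"
abbreviation "srec_tm X Y a f s \<equiv> Const (SRec_c X Y) \<cdot> a \<cdot> f \<cdot> s"

inductive HA_omega :: axioms where
  beta: "\<sigma> # \<Gamma> \<turnstile> t : \<tau> \<Longrightarrow> \<Gamma> \<turnstile> u : \<sigma> \<Longrightarrow>
    HA_omega \<Gamma> (Eq \<tau> (Lam \<sigma> t \<cdot> u) (subst (inst u) t))"
| ext: "\<Gamma> \<turnstile> f : \<sigma> \<rightarrow> \<tau> \<Longrightarrow> \<Gamma> \<turnstile> g : \<sigma> \<rightarrow> \<tau> \<Longrightarrow>
    HA_omega \<Gamma> (Imp (All \<sigma> (Eq \<tau> (lift f \<cdot> Var 0) (lift g \<cdot> Var 0))) (Eq (\<sigma> \<rightarrow> \<tau>) f g))"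
| if_true: "\<Gamma> \<turnstile> t : X \<Longrightarrow> \<Gamma> \<turnstile> u : X \<Longrightarrow> HA_omega \<Gamma> (Eq X (if_tm X tt t u) t)"
| if_false: "\<Gamma> \<turnstile> t : X \<Longrightarrow> \<Gamma> \<turnstile> u : X \<Longrightarrow> HA_omega \<Gamma> (Eq X (if_tm X ff t u) u)"
| bool_cases: "wff (Bool # \<Gamma>) \<phi> \<Longrightarrow>
    HA_omega \<Gamma> (Imp (fsubst (inst tt) \<phi>) (Imp (fsubst (inst ff) \<phi>) (All Bool \<phi>)))"
| fst_pair: "\<Gamma> \<turnstile> a : X \<Longrightarrow> \<Gamma> \<turnstile> b : Y \<Longrightarrow> HA_omega \<Gamma> (Eq X (fst_tm X Y (pair_tm X Y a b)) a)"
| snd_pair: "\<Gamma> \<turnstile> a : X \<Longrightarrow> \<Gamma> \<turnstile> b : Y \<Longrightarrow> HA_omega \<Gamma> (Eq Y (snd_tm X Y (pair_tm X Y a b)) b)"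
| pair_eta: "\<Gamma> \<turnstile> p : Prod X Y \<Longrightarrow>
    HA_omega \<Gamma> (Eq (Prod X Y) (pair_tm X Y (fst_tm X Y p) (snd_tm X Y p)) p)"
| suc_neq_zero: "\<Gamma> \<turnstile> n : Nat \<Longrightarrow> HA_omega \<Gamma> (Neg (Eq Nat (suc_tm n) zero_tm))"
| suc_inj: "\<Gamma> \<turnstile> m : Nat \<Longrightarrow> \<Gamma> \<turnstile> n : Nat \<Longrightarrow>
    HA_omega \<Gamma> (Imp (Eq Nat (suc_tm m) (suc_tm n)) (Eq Nat m n))"
| rec_zero: "\<Gamma> \<turnstile> a : X \<Longrightarrow> \<Gamma> \<turnstile> f : Nat \<rightarrow> X \<rightarrow> X \<Longrightarrow> HA_omega \<Gamma> (Eq X (nrec_tm X a f zero_tm) a)"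
| rec_suc: "\<Gamma> \<turnstile> a : X \<Longrightarrow> \<Gamma> \<turnstile> f : Nat \<rightarrow> X \<rightarrow> X \<Longrightarrow> \<Gamma> \<turnstile> n : Nat \<Longrightarrow>
    HA_omega \<Gamma> (Eq X (nrec_tm X a f (suc_tm n)) (f \<cdot> n \<cdot> nrec_tm X a f n))"
| nat_induct: "wff (Nat # \<Gamma>) \<phi> \<Longrightarrow>
    HA_omega \<Gamma> (Imp (fsubst (inst zero_tm) \<phi>)
      (Imp (All Nat (Imp \<phi> (fsubst (repl 1 (suc_tm (Var 0))) \<phi>))) (All Nat \<phi>)))"
| srec_nil: "\<Gamma> \<turnstile> a : Y \<Longrightarrow> \<Gamma> \<turnstile> f : X \<rightarrow> Seq X \<rightarrow> Y \<rightarrow> Y \<Longrightarrow>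
    HA_omega \<Gamma> (Eq Y (srec_tm X Y a f (nil_tm X)) a)"
| srec_cons: "\<Gamma> \<turnstile> a : Y \<Longrightarrow> \<Gamma> \<turnstile> f : X \<rightarrow> Seq X \<rightarrow> Y \<rightarrow> Y \<Longrightarrow> \<Gamma> \<turnstile> x : X \<Longrightarrow> \<Gamma> \<turnstile> s : Seq X \<Longrightarrow>
    HA_omega \<Gamma> (Eq Y (srec_tm X Y a f (cons_tm X x s)) (f \<cdot> x \<cdot> s \<cdot> srec_tm X Y a f s))"
  \<comment> \<open>in the step, variable 0 is the tail and variable 1 the head\<close>
| seq_induct: "wff (Seq X # \<Gamma>) \<phi> \<Longrightarrow>
    HA_omega \<Gamma> (Imp (fsubst (inst (nil_tm X)) \<phi>)
      (Imp (All X (All (Seq X) (Imp (fsubst (repl 2 (Var 0)) \<phi>)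
                                    (fsubst (repl 2 (cons_tm X (Var 1) (Var 0))) \<phi>))))
        (All (Seq X) \<phi>)))"


section \<open>T-definability\<close>

text \<open>For each choice of type parameters, a specification gives the type of the functional and its
  defining equation, a formula whose only free variable, of index 0, stands for the functional.\<close>

record 'p spec =
  spec_ty :: "'p \<Rightarrow> ty"
  spec_eqn :: "'p \<Rightarrow> fm"

text \<open>\<open>T_definable S F G\<close> says that \<open>G\<close> is T-definable from \<open>F\<close> over \<open>S\<close>. In the derivation, \<open>F\<close> is a
  variable about which only its defining equation is assumed.\<close>

definition T_definable :: "axioms \<Rightarrow> 'p spec \<Rightarrow> 'q spec \<Rightarrow> bool" where
  "T_definable S F G \<longleftrightarrow>
    (\<forall>q. \<exists>p s. [] \<turnstile> s : spec_ty F p \<rightarrow> spec_ty G q \<and>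
      derives S [spec_ty F p] [spec_eqn F p] (fsubst (repl 1 (s \<cdot> Var 0)) (spec_eqn G q)))"


section \<open>Operations on sequences\<close>

text \<open>All types \<open>X\<^sub>i\<close> are one type \<open>X\<close>: infinite sequences have type \<open>Stream X\<close>.\<close>

abbreviation Stream :: "ty \<Rightarrow> ty" where
  "Stream X \<equiv> Nat \<rightarrow> X"

primrec zero :: "ty \<Rightarrow> tm" where
  "zero Bool = ff"
| "zero Nat = zero_tm"
| "zero (Prod X Y) = pair_tm X Y (zero X) (zero Y)"
| "zero (X \<rightarrow> Y) = Lam X (zero Y)"
| "zero (Seq X) = nil_tm X"

text \<open>The comments list the bound variables, outermost first.\<close>

definition less_fun :: tm where  \<comment> \<open>\<open>\<lambda>m n. rec (\<lambda>k. False) (\<lambda>n' r k. rec True (\<lambda>k' _. r k') k) n m\<close>\<close>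
  "less_fun = Lam Nat (Lam Nat (nrec_tm (Nat \<rightarrow> Bool)
     (Lam Nat ff)
     (Lam Nat (Lam (Nat \<rightarrow> Bool) (Lam Nat
        (nrec_tm Bool tt (Lam Nat (Lam Bool (Var 3 \<cdot> Var 1))) (Var 0)))))
     (Var 0) \<cdot> Var 1))"

definition len_fun :: "ty \<Rightarrow> tm" where
  "len_fun X = Lam (Seq X)
     (srec_tm X Nat zero_tm (Lam X (Lam (Seq X) (Lam Nat (suc_tm (Var 0))))) (Var 0))"

definition append_fun :: "ty \<Rightarrow> tm" where  \<comment> \<open>\<open>\<lambda>s t. srec t (\<lambda>x s' r. cons x r) s\<close>\<close>
  "append_fun X = Lam (Seq X) (Lam (Seq X) (srec_tm X (Seq X) (Var 0)
     (Lam X (Lam (Seq X) (Lam (Seq X) (cons_tm X (Var 2) (Var 0))))) (Var 1)))"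

text \<open>Concatenation of a finite and an infinite sequence.\<close>

definition conc_fun :: "ty \<Rightarrow> tm" where  \<comment> \<open>\<open>\<lambda>s \<alpha>. srec \<alpha> (\<lambda>x s' r n. rec x (\<lambda>m _. r m) n) s\<close>\<close>
  "conc_fun X = Lam (Seq X) (Lam (Stream X) (srec_tm X (Stream X) (Var 0)
     (Lam X (Lam (Seq X) (Lam (Stream X) (Lam Nat
        (nrec_tm X (Var 3) (Lam Nat (Lam X (Var 3 \<cdot> Var 1))) (Var 0)))))) (Var 1)))"

abbreviation less :: "tm \<Rightarrow> tm \<Rightarrow> tm" where
  "less m n \<equiv> less_fun \<cdot> m \<cdot> n"

abbreviation len :: "ty \<Rightarrow> tm \<Rightarrow> tm" where
  "len X s \<equiv> len_fun X \<cdot> s"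

abbreviation single :: "ty \<Rightarrow> tm \<Rightarrow> tm" where
  "single X x \<equiv> cons_tm X x (nil_tm X)"

abbreviation append :: "ty \<Rightarrow> tm \<Rightarrow> tm \<Rightarrow> tm" where
  "append X s t \<equiv> append_fun X \<cdot> s \<cdot> t"

abbreviation conc :: "ty \<Rightarrow> tm \<Rightarrow> tm \<Rightarrow> tm" where
  "conc X s \<alpha> \<equiv> conc_fun X \<cdot> s \<cdot> \<alpha>"

abbreviation entry :: "ty \<Rightarrow> tm \<Rightarrow> tm \<Rightarrow> tm" where  \<comment> \<open>the \<open>i\<close>-th entry of \<open>s\<close> if \<open>i < |s|\<close>\<close>
  "entry X s i \<equiv> conc X s (zero (Stream X)) \<cdot> i"

definition overwrite_fun :: "ty \<Rightarrow> tm" where  \<comment> \<open>\<open>\<lambda>s \<alpha> i. if i < |s| then s\<^sub>i else \<alpha> i\<close>\<close>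
  "overwrite_fun X = Lam (Seq X) (Lam (Stream X) (Lam Nat
     (if_tm X (less (Var 0) (len X (Var 2))) (entry X (Var 2) (Var 0)) (Var 1 \<cdot> Var 0))))"

abbreviation overwrite :: "ty \<Rightarrow> tm \<Rightarrow> tm \<Rightarrow> tm" where
  "overwrite X s \<alpha> \<equiv> overwrite_fun X \<cdot> s \<cdot> \<alpha>"

text \<open>\<open>shift X q x\<close> is \<open>q\<^sub>x = (\<lambda>\<alpha>. q (\<langle>x\<rangle> * \<alpha>))\<close>.\<close>

definition shift :: "ty \<Rightarrow> tm \<Rightarrow> tm \<Rightarrow> tm" where
  "shift X q x = Lam (Stream X) (lift q \<cdot> conc X (single X (lift x)) (Var 0))"


section \<open>The functionals EPS and SBR\<close>

abbreviation J :: "ty \<Rightarrow> ty \<Rightarrow> ty" where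
  "J R X \<equiv> (X \<rightarrow> R) \<rightarrow> X"

definition EPS_ty :: "ty \<Rightarrow> ty \<Rightarrow> ty" where
  "EPS_ty X R = (R \<rightarrow> Nat) \<rightarrow> (Seq X \<rightarrow> J R X) \<rightarrow> Seq X \<rightarrow> (Stream X \<rightarrow> R) \<rightarrow> Stream X"

text \<open>\<open>E\<close> is the functional, applied to \<open>\<ell>\<close>, \<open>\<epsilon>\<close>, \<open>s\<close> and \<open>q\<close> in this order.\<close>

definition EPS_rhs :: "ty \<Rightarrow> tm \<Rightarrow> tm \<Rightarrow> tm \<Rightarrow> tm \<Rightarrow> tm \<Rightarrow> tm" where
  "EPS_rhs X E l e s q =
    (let p = Lam X (let x = Var 0; qx = shift X (lift q) x in
           qx \<cdot> (lift E \<cdot> lift l \<cdot> lift e \<cdot> append X (lift s) (single X x) \<cdot> qx));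
         c = e \<cdot> s \<cdot> p
     in if_tm (Stream X) (less (l \<cdot> (q \<cdot> zero (Stream X))) (len X s))
          (zero (Stream X))
          (conc X (single X c) (E \<cdot> l \<cdot> e \<cdot> append X s (single X c) \<cdot> shift X q c)))"

definition EPS_eqn :: "ty \<Rightarrow> ty \<Rightarrow> fm" where
  "EPS_eqn X R =
    All (R \<rightarrow> Nat) (All (Seq X \<rightarrow> J R X) (All (Seq X) (All (Stream X \<rightarrow> R)
      (let E = Var 4; l = Var 3; e = Var 2; s = Var 1; q = Var 0 in
        Eq (Stream X) (E \<cdot> l \<cdot> e \<cdot> s \<cdot> q) (EPS_rhs X E l e s q)))))"

definition EPS :: "(ty \<times> ty) spec" where
  "EPS = \<lparr>spec_ty = (\<lambda>(X, R). EPS_ty X R), spec_eqn = (\<lambda>(X, R). EPS_eqn X R)\<rparr>"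

definition SBR_ty :: "ty \<Rightarrow> ty" where
  "SBR_ty X = (Stream X \<rightarrow> Nat) \<rightarrow> (Seq X \<rightarrow> J (Stream X) X) \<rightarrow> Seq X \<rightarrow> Stream X"

text \<open>\<open>B\<close> is the functional, applied to \<open>\<omega>\<close>, \<open>\<epsilon>\<close> and \<open>s\<close> in this order.\<close>

definition SBR_rhs :: "ty \<Rightarrow> tm \<Rightarrow> tm \<Rightarrow> tm \<Rightarrow> tm \<Rightarrow> tm" where
  "SBR_rhs X B w e s =
    (let p = Lam X (let x = Var 0 in
           lift B \<cdot> lift w \<cdot> lift e \<cdot> append X (lift s) (single X x));
         c = e \<cdot> s \<cdot> p
     in if_tm (Stream X) (less (w \<cdot> conc X s (zero (Stream X))) (len X s))
          (overwrite X s (zero (Stream X)))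
          (overwrite X s (B \<cdot> w \<cdot> e \<cdot> append X s (single X c))))"

definition SBR_eqn :: "ty \<Rightarrow> fm" where
  "SBR_eqn X =
    All (Stream X \<rightarrow> Nat) (All (Seq X \<rightarrow> J (Stream X) X) (All (Seq X)
      (let B = Var 3; w = Var 2; e = Var 1; s = Var 0 in
        Eq (Stream X) (B \<cdot> w \<cdot> e \<cdot> s) (SBR_rhs X B w e s))))"

definition SBR :: "ty spec" where
  "SBR = \<lparr>spec_ty = SBR_ty, spec_eqn = SBR_eqn\<rparr>"

lemma typing_zero: "\<Gamma> \<turnstile> zero X : X"
  by (induction X arbitrary: \<Gamma>) (auto intro!: typing.intros)

lemma wff_EPS_eqn: "wff [EPS_ty X R] (EPS_eqn X R)"
  by (simp add: EPS_eqn_def EPS_ty_def EPS_rhs_def Let_def shift_def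
        less_fun_def len_fun_def append_fun_def conc_fun_def del: zero.simps)
    ((rule conjI | rule typing_zero | rule typing.intros | simp del: zero.simps)+)

lemma wff_SBR_eqn: "wff [SBR_ty X] (SBR_eqn X)"
  by (simp add: SBR_eqn_def SBR_ty_def SBR_rhs_def Let_def overwrite_fun_def
        less_fun_def len_fun_def append_fun_def conc_fun_def del: zero.simps)
    ((rule conjI | rule typing_zero | rule typing.intros | simp del: zero.simps)+)

end

theory Submission
  imports Defs
begin

text \<open>Take for \<open>R\<close> the type of infinite sequences, for \<open>\<ell>\<close> the functional \<open>\<omega>\<close>, and put
  \<open>SBR\<^sub>s(\<epsilon>) = s * EPS\<^sub>s(\<epsilon>)(q)\<close> with \<open>q = (\<lambda>\<alpha>. s * \<alpha>)\<close>. Associativity of concatenation gives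
  \<open>q\<^sub>x = (\<lambda>\<alpha>. (s * x) * \<alpha>)\<close>, so \<open>q\<^sub>x(EPS\<^sub>s\<^sub>*\<^sub>x(\<epsilon>)(q\<^sub>x)) = SBR\<^sub>s\<^sub>*\<^sub>x(\<epsilon>)\<close> and the two recursions select the
  same \<open>c\<close>; the stopping conditions agree because \<open>q(0) = s * 0\<close>. Overwriting with \<open>s\<close> is
  prepending \<open>s\<close> to the zero sequence and leaves every sequence of the form \<open>s * \<alpha>\<close> unchanged.\<close>

section \<open>Substitution\<close>

text \<open>Indices in concrete terms are written as numerals, which the simplifier does not see as
  successors; hence the third rule, here and for \<open>inst\<close> and
  \<open>repl\<close>.\<close>

lemma under_simps [simp]:
  "under \<theta> 0 = Var 0" "under \<theta> (Suc i) = lift (\<theta> i)"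
  "under \<theta> (numeral n) = lift (\<theta> (pred_numeral n))"
  by (simp_all add: under_def)

lemma inst_simps [simp]:
  "inst u 0 = u" "inst u (Suc i) = Var i" "inst u (numeral n) = Var (pred_numeral n)"
  by (simp_all add: inst_def)

lemma repl_simps [simp]:
  "repl k u 0 = u" "repl k u (Suc i) = Var (k + i)" "repl k u (numeral n) = Var (k + pred_numeral n)"
  by (simp_all add: repl_def)

lemma rename_rename: "rename \<rho> (rename \<sigma> t) = rename (\<lambda>i. \<rho> (\<sigma> i)) t"
proof (induction t arbitrary: \<rho> \<sigma>)
  case (Lam \<tau> t)
  have "(\<lambda>i. case_nat 0 (\<lambda>i. Suc (\<rho> i)) (case_nat 0 (\<lambda>i. Suc (\<sigma> i)) i))
      = case_nat 0 (\<lambda>i. Suc (\<rho> (\<sigma> i)))"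
    by (auto split: nat.split)
  with Lam show ?case by simp
qed auto

lemma subst_rename: "subst \<theta> (rename \<rho> t) = subst (\<lambda>i. \<theta> (\<rho> i)) t"
proof (induction t arbitrary: \<theta> \<rho>)
  case (Lam \<tau> t)
  have "(\<lambda>i. under \<theta> (case_nat 0 (\<lambda>i. Suc (\<rho> i)) i)) = under (\<lambda>i. \<theta> (\<rho> i))"
    by (auto simp: under_def split: nat.split)
  with Lam show ?case by simp
qed auto

lemma rename_subst: "rename \<rho> (subst \<theta> t) = subst (\<lambda>i. rename \<rho> (\<theta> i)) t"
proof (induction t arbitrary: \<theta> \<rho>)
  case (Lam \<tau> t)
  have "(\<lambda>i. rename (case_nat 0 (\<lambda>i. Suc (\<rho> i))) (under \<theta> i)) = under (\<lambda>i. rename \<rho> (\<theta> i))"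
    by (auto simp: under_def rename_rename split: nat.split)
  with Lam show ?case by simp
qed auto

lemma under_Var [simp]: "under Var = Var"
  by (auto simp: under_def split: nat.split)

lemma subst_Var [simp]: "subst Var t = t"
  by (induction t) auto

text \<open>Terms are lifted by renaming but formulas by substitution. This identifies the two, so
  that lifted assumptions simplify to lifted terms.\<close>

lemma subst_Var_comp: "subst (\<lambda>i. Var (\<rho> i)) t = rename \<rho> t"
  using rename_subst[of \<rho> Var t] by simp

lemma subst_Suc_Var [simp]: "subst (\<lambda>i. Var (Suc i)) t = lift t"
  by (rule subst_Var_comp)

text \<open>By the composition laws both sides are the single substitution
  \<open>lift (\<theta> i)\<close> for variable \<open>i\<close>.\<close>

lemma subst_under_lift [simp]: "subst (under \<theta>) (lift t) = lift (subst \<theta> t)"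
  by (simp add: subst_rename rename_subst)

lemma subst_inst_lift [simp]: "subst (inst u) (lift t) = t"
  by (simp add: subst_rename)

text \<open>A lifted term does not mention variable 0, so only the passage to a context with one or
  two variables in its place remains.\<close>

lemma subst_repl_lift [simp]:
  "subst (repl (Suc 0) u) (lift t) = lift t" "subst (repl 2 u) (lift t) = lift (lift t)"
  "subst (repl (Suc (Suc 0)) u) (lift t) = lift (lift t)"
  by (simp_all add: subst_rename rename_rename subst_Var_comp)

text \<open>\<open>Lam \<sigma> t\<close> is lifted by renaming in \<open>t\<close> from index 1 on.\<close>

lemma subst_inst_rename_under [simp]:
  "subst (inst (Var 0)) (rename (case_nat 0 (\<lambda>i. Suc (Suc i))) t) = t"
proof -
  have "(\<lambda>i. inst (Var 0) (case_nat 0 (\<lambda>i. Suc (Suc i)) i)) = Var"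
    by (auto split: nat.split)
  then show ?thesis by (simp add: subst_rename)
qed

lemma rename_zero [simp]: "rename \<rho> (zero X) = zero X"
  by (induction X arbitrary: \<rho>) auto

lemma subst_zero [simp]: "subst \<theta> (zero X) = zero X"
  by (induction X arbitrary: \<theta>) auto


section \<open>Type inference\<close>

text \<open>Types are unique, so typing can be decided by rewriting.\<close>

primrec infer :: "ctx \<Rightarrow> tm \<Rightarrow> ty option" where
  "infer \<Gamma> (Var i) = (if i < length \<Gamma> then Some (\<Gamma> ! i) else None)"
| "infer \<Gamma> (Const c) = Some (const_ty c)"
| "infer \<Gamma> (Lam \<sigma> t) = map_option (Fun \<sigma>) (infer (\<sigma> # \<Gamma>) t)"
| "infer \<Gamma> (t \<cdot> u) = (case infer \<Gamma> t of
     Some (\<sigma> \<rightarrow> \<tau>) \<Rightarrow> if infer \<Gamma> u = Some \<sigma> then Some \<tau> else None | _ \<Rightarrow> None)"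

text \<open>Lookup proceeds entry by entry and thus keeps the form
  \<open>infer \<Gamma> (Var i)\<close> when the rest of the context is unknown, as the hypotheses
  of \<open>infer_rename\<close> and \<open>infer_subst\<close> require.\<close>

lemma infer_Var_simps [simp]:
  "infer (\<sigma> # \<Gamma>) (Var 0) = Some \<sigma>" "infer (\<sigma> # \<Gamma>) (Var (Suc i)) = infer \<Gamma> (Var i)"
  "infer (\<sigma> # \<Gamma>) (Var (numeral n)) = infer \<Gamma> (Var (pred_numeral n))"
  by (simp_all add: numeral_eq_Suc)

declare infer.simps(1) [simp del]

lemma typing_iff_infer: "\<Gamma> \<turnstile> t : \<tau> \<longleftrightarrow> infer \<Gamma> t = Some \<tau>"
proof
  show "infer \<Gamma> t = Some \<tau>" if "\<Gamma> \<turnstile> t : \<tau>"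
    using that by induction (auto simp: infer.simps(1))
  show "\<Gamma> \<turnstile> t : \<tau>" if "infer \<Gamma> t = Some \<tau>"
    using that
  proof (induction t arbitrary: \<Gamma> \<tau>)
    case (App t u)
    then obtain \<sigma> where "infer \<Gamma> t = Some (\<sigma> \<rightarrow> \<tau>)" "infer \<Gamma> u = Some \<sigma>"
      by (auto split: option.splits ty.splits if_splits)
    with App.IH show ?case by (blast intro: typing.App)
  qed (auto simp: infer.simps(1) intro: typing.intros split: if_splits)
qed

text \<open>The hypothesis also compares failing lookups, so the conclusion is an unconditional
  equation and \<open>infer_lift\<close> can serve as a rewrite rule.\<close>

lemma infer_rename:
  assumes "\<And>i. infer \<Delta> (Var (\<rho> i)) = infer \<Gamma> (Var i)"
  shows "infer \<Delta> (rename \<rho> t) = infer \<Gamma> t"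
  using assms
proof (induction t arbitrary: \<Delta> \<Gamma> \<rho>)
  case (Lam \<sigma> t)
  have "infer (\<sigma> # \<Delta>) (rename (case_nat 0 (\<lambda>i. Suc (\<rho> i))) t) = infer (\<sigma> # \<Gamma>) t"
    by (rule Lam.IH) (auto simp: Lam.prems split: nat.split)
  then show ?case by simp
next
  case (App t u)
  from App.IH[of \<Delta> \<rho> \<Gamma>, OF App.prems] show ?case
    by (simp split: option.split ty.split)
qed auto

lemma infer_lift [simp]: "infer (\<sigma> # \<Gamma>) (lift t) = infer \<Gamma> t"
  by (rule infer_rename) simp

text \<open>Unlike renaming, this is an implication only: a substitution may put a typable term in
  place of a variable outside the context.\<close>

lemma infer_subst:
  assumes "\<And>i \<sigma>. infer \<Gamma> (Var i) = Some \<sigma> \<Longrightarrow> infer \<Delta> (\<theta> i) = Some \<sigma>"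
    and "infer \<Gamma> t = Some \<tau>"
  shows "infer \<Delta> (subst \<theta> t) = Some \<tau>"
  using assms
proof (induction t arbitrary: \<Delta> \<Gamma> \<theta> \<tau>)
  case (Lam \<sigma> t)
  from Lam.prems(2) obtain \<tau>' where t: "infer (\<sigma> # \<Gamma>) t = Some \<tau>'" and \<tau>: "\<tau> = \<sigma> \<rightarrow> \<tau>'"
    by auto
  have "infer (\<sigma> # \<Delta>) (subst (under \<theta>) t) = Some \<tau>'"
  proof (rule Lam.IH[OF _ t])
    show "infer (\<sigma> # \<Delta>) (under \<theta> i) = Some \<upsilon>" if "infer (\<sigma> # \<Gamma>) (Var i) = Some \<upsilon>" for i \<upsilon>
      using that by (cases i) (auto intro: Lam.prems(1))
  qed
  then show ?case using \<tau> by simp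
next
  case (App t u)
  from App.prems(2) obtain \<sigma> where "infer \<Gamma> t = Some (\<sigma> \<rightarrow> \<tau>)" "infer \<Gamma> u = Some \<sigma>"
    by (auto split: option.splits ty.splits if_splits)
  with App.IH(1)[OF App.prems(1)] App.IH(2)[OF App.prems(1)]
  show ?case by simp
qed auto

lemma infer_subst_inst:
  assumes "infer (\<sigma> # \<Gamma>) t = Some \<tau>" "infer \<Gamma> u = Some \<sigma>"
  shows "infer \<Gamma> (subst (inst u) t) = Some \<tau>"
proof (rule infer_subst[OF _ assms(1)])
  show "infer \<Gamma> (inst u i) = Some \<upsilon>" if "infer (\<sigma> # \<Gamma>) (Var i) = Some \<upsilon>" for i \<upsilon>
    using that assms(2) by (cases i) auto
qed

text \<open>Together with \<open>rename_zero\<close> and \<open>subst_zero\<close> this lets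
  \<open>zero X\<close> be treated as an opaque constant.\<close>

lemma infer_zero [simp]: "infer \<Gamma> (zero X) = Some X"
  using typing_zero by (simp add: typing_iff_infer)

declare zero.simps [simp del]


section \<open>Provable equality\<close>

text \<open>The typings are bundled with the derivation because the logical rules have typing side
  conditions; chained equations then carry them along.\<close>

definition conv :: "ctx \<Rightarrow> fm list \<Rightarrow> ty \<Rightarrow> tm \<Rightarrow> tm \<Rightarrow> bool" where
  "conv \<Gamma> \<Phi> \<tau> t u \<longleftrightarrow>
     infer \<Gamma> t = Some \<tau> \<and> infer \<Gamma> u = Some \<tau> \<and> derives HA_omega \<Gamma> \<Phi> (Eq \<tau> t u)"

lemma conv_infer:
  assumes "conv \<Gamma> \<Phi> \<tau> t u"
  shows "infer \<Gamma> t = Some \<tau>" "infer \<Gamma> u = Some \<tau>"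
  using assms by (auto simp: conv_def)

lemma conv_derives: "conv \<Gamma> \<Phi> \<tau> t u \<Longrightarrow> derives HA_omega \<Gamma> \<Phi> (Eq \<tau> t u)"
  by (simp add: conv_def)

lemma conv_refl: "infer \<Gamma> t = Some \<tau> \<Longrightarrow> conv \<Gamma> \<Phi> \<tau> t t"
  by (simp add: conv_def typing_iff_infer EqI)

text \<open>Replacement of equals in the formula "variable 0 equals \<open>t\<close>", starting from
  reflexivity. Transitivity uses the mirrored formula.\<close>

lemma conv_sym:
  assumes "conv \<Gamma> \<Phi> \<tau> t u"
  shows "conv \<Gamma> \<Phi> \<tau> u t"
  using assms EqE[of HA_omega \<Gamma> \<Phi> \<tau> t u "Eq \<tau> (Var 0) (lift t)"] EqI[of \<Gamma> t \<tau> HA_omega \<Phi>]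
  by (simp add: conv_def typing_iff_infer)

lemma conv_trans [trans]:
  assumes "conv \<Gamma> \<Phi> \<tau> t u" "conv \<Gamma> \<Phi> \<tau> u v"
  shows "conv \<Gamma> \<Phi> \<tau> t v"
  using assms EqE[of HA_omega \<Gamma> \<Phi> \<tau> u v "Eq \<tau> (lift t) (Var 0)"]
  by (simp add: conv_def typing_iff_infer)

text \<open>Variable 0 of \<open>c\<close> marks the place at which equals are replaced.\<close>

lemma conv_cong:
  assumes "conv \<Gamma> \<Phi> \<sigma> t u" and c: "infer (\<sigma> # \<Gamma>) c = Some \<tau>"
  shows "conv \<Gamma> \<Phi> \<tau> (subst (inst t) c) (subst (inst u) c)"
proof -
  from assms have tu: "infer \<Gamma> (subst (inst t) c) = Some \<tau>" "infer \<Gamma> (subst (inst u) c) = Some \<tau>"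
    by (simp_all add: infer_subst_inst[where \<sigma> = \<sigma>] conv_def)
  \<comment> \<open>The left side is fixed by \<open>lift\<close>, so the instance of this formula
    at \<open>t\<close> is an instance of reflexivity.\<close>
  have "derives HA_omega \<Gamma> \<Phi> (fsubst (inst u) (Eq \<tau> (lift (subst (inst t) c)) c))"
    by (rule EqE[of _ _ _ \<sigma> t]) (use assms tu in \<open>auto simp: conv_def typing_iff_infer intro: EqI\<close>)
  with tu show ?thesis by (simp add: conv_def)
qed

lemma conv_fun:
  assumes "conv \<Gamma> \<Phi> (\<sigma> \<rightarrow> \<tau>) f g" "infer \<Gamma> a = Some \<sigma>"
  shows "conv \<Gamma> \<Phi> \<tau> (f \<cdot> a) (g \<cdot> a)"
  using conv_cong[OF assms(1), of "Var 0 \<cdot> lift a" \<tau>] assms by simp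

lemma conv_arg:
  assumes "conv \<Gamma> \<Phi> \<sigma> a b" "infer \<Gamma> f = Some (\<sigma> \<rightarrow> \<tau>)"
  shows "conv \<Gamma> \<Phi> \<tau> (f \<cdot> a) (f \<cdot> b)"
  using conv_cong[OF assms(1), of "lift f \<cdot> Var 0" \<tau>] assms by simp

lemma conv_app:
  assumes "conv \<Gamma> \<Phi> (\<sigma> \<rightarrow> \<tau>) f g" "conv \<Gamma> \<Phi> \<sigma> a b"
  shows "conv \<Gamma> \<Phi> \<tau> (f \<cdot> a) (g \<cdot> b)"
  using conv_trans[OF conv_fun[OF assms(1)] conv_arg[OF assms(2)]] assms
  by (simp add: conv_def)

lemma conv_beta:
  assumes "infer (\<sigma> # \<Gamma>) t = Some \<tau>" "infer \<Gamma> u = Some \<sigma>"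
  shows "conv \<Gamma> \<Phi> \<tau> (Lam \<sigma> t \<cdot> u) (subst (inst u) t)"
  using assms by (simp add: conv_def typing_iff_infer infer_subst_inst[where \<sigma> = \<sigma>] Ax beta)

text \<open>The first argument is substituted below the remaining abstraction, which turns
  \<open>inst u\<close> into \<open>under (inst u)\<close>; a second beta step follows. The versions
  for more arguments iterate this.\<close>

lemma conv_beta2:
  assumes "infer (\<sigma> # \<rho> # \<Gamma>) t = Some \<tau>" "infer \<Gamma> u = Some \<rho>" "infer \<Gamma> v = Some \<sigma>"
  shows "conv \<Gamma> \<Phi> \<tau> (Lam \<rho> (Lam \<sigma> t) \<cdot> u \<cdot> v) (subst (inst v) (subst (under (inst u)) t))"
proof -
  have 1: "conv \<Gamma> \<Phi> (\<sigma> \<rightarrow> \<tau>) (Lam \<rho> (Lam \<sigma> t) \<cdot> u) (Lam \<sigma> (subst (under (inst u)) t))"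
    using conv_beta[of \<rho> \<Gamma> "Lam \<sigma> t" "\<sigma> \<rightarrow> \<tau>" u \<Phi>] assms by simp
  \<comment> \<open>The reduct inherits its type from the equation just proved.\<close>
  then have "infer (\<sigma> # \<Gamma>) (subst (under (inst u)) t) = Some \<tau>"
    by (auto simp: conv_def)
  then show ?thesis
    by (rule conv_trans[OF conv_fun[OF 1 assms(3)] conv_beta]) (rule assms(3))
qed

lemma conv_beta3:
  assumes "infer (\<sigma> # \<rho> # \<upsilon> # \<Gamma>) t = Some \<tau>"
    and "infer \<Gamma> u = Some \<upsilon>" "infer \<Gamma> v = Some \<rho>" "infer \<Gamma> w = Some \<sigma>"
  shows "conv \<Gamma> \<Phi> \<tau> (Lam \<upsilon> (Lam \<rho> (Lam \<sigma> t)) \<cdot> u \<cdot> v \<cdot> w)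
    (subst (inst w) (subst (under (inst v)) (subst (under (under (inst u))) t)))"
proof -
  have 1: "conv \<Gamma> \<Phi> (\<sigma> \<rightarrow> \<tau>) (Lam \<upsilon> (Lam \<rho> (Lam \<sigma> t)) \<cdot> u \<cdot> v)
      (Lam \<sigma> (subst (under (inst v)) (subst (under (under (inst u))) t)))"
    using conv_beta2[of \<rho> \<upsilon> \<Gamma> "Lam \<sigma> t" "\<sigma> \<rightarrow> \<tau>" u v \<Phi>] assms by simp
  then have "infer (\<sigma> # \<Gamma>) (subst (under (inst v)) (subst (under (under (inst u))) t)) = Some \<tau>"
    by (auto simp: conv_def)
  then show ?thesis
    by (rule conv_trans[OF conv_fun[OF 1 assms(4)] conv_beta]) (rule assms(4))
qed

lemma conv_beta4:
  assumes "infer (\<sigma> # \<rho> # \<upsilon> # \<phi> # \<Gamma>) t = Some \<tau>"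
    and "infer \<Gamma> u = Some \<phi>" "infer \<Gamma> v = Some \<upsilon>" "infer \<Gamma> w = Some \<rho>" "infer \<Gamma> z = Some \<sigma>"
  shows "conv \<Gamma> \<Phi> \<tau> (Lam \<phi> (Lam \<upsilon> (Lam \<rho> (Lam \<sigma> t))) \<cdot> u \<cdot> v \<cdot> w \<cdot> z)
    (subst (inst z) (subst (under (inst w))
      (subst (under (under (inst v))) (subst (under (under (under (inst u)))) t))))"
proof -
  let ?t = "subst (under (inst w)) (subst (under (under (inst v))) (subst (under (under (under (inst u)))) t))"
  have 1: "conv \<Gamma> \<Phi> (\<sigma> \<rightarrow> \<tau>) (Lam \<phi> (Lam \<upsilon> (Lam \<rho> (Lam \<sigma> t))) \<cdot> u \<cdot> v \<cdot> w) (Lam \<sigma> ?t)"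
    using conv_beta3[of \<rho> \<upsilon> \<phi> \<Gamma> "Lam \<sigma> t" "\<sigma> \<rightarrow> \<tau>" u v w \<Phi>] assms by simp
  then have "infer (\<sigma> # \<Gamma>) ?t = Some \<tau>"
    by (auto simp: conv_def)
  then show ?thesis
    by (rule conv_trans[OF conv_fun[OF 1 assms(5)] conv_beta]) (rule assms(5))
qed

lemma conv_ext:
  assumes "infer \<Gamma> f = Some (\<sigma> \<rightarrow> \<tau>)" "infer \<Gamma> g = Some (\<sigma> \<rightarrow> \<tau>)"
    and "conv (\<sigma> # \<Gamma>) (map flift \<Phi>) \<tau> (lift f \<cdot> Var 0) (lift g \<cdot> Var 0)"
  shows "conv \<Gamma> \<Phi> (\<sigma> \<rightarrow> \<tau>) f g"
  using ImpE[OF Ax[of HA_omega, OF HA_omega.ext] AllI] assms by (simp add: conv_def typing_iff_infer)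

text \<open>Equality below an abstraction is not a primitive rule; it follows from extensionality,
  since both abstractions applied to a fresh variable reduce to their bodies.\<close>

lemma conv_Lam:
  assumes "conv (\<sigma> # \<Gamma>) (map flift \<Phi>) \<tau> t u"
  shows "conv \<Gamma> \<Phi> (\<sigma> \<rightarrow> \<tau>) (Lam \<sigma> t) (Lam \<sigma> u)"
proof (rule conv_ext)
  have beta: "conv (\<sigma> # \<Gamma>) (map flift \<Phi>) \<tau> (lift (Lam \<sigma> v) \<cdot> Var 0) v"
    if "infer (\<sigma> # \<Gamma>) v = Some \<tau>" for v
  proof -
    have "infer (\<sigma> # \<Gamma>) (lift (Lam \<sigma> v)) = Some (\<sigma> \<rightarrow> \<tau>)"
      using that by (simp del: rename.simps)
    then show ?thesis
      using conv_beta[of \<sigma> "\<sigma> # \<Gamma>" "rename (case_nat 0 (\<lambda>i. Suc (Suc i))) v" \<tau> "Var 0"] by simp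
  qed
  show "conv (\<sigma> # \<Gamma>) (map flift \<Phi>) \<tau> (lift (Lam \<sigma> t) \<cdot> Var 0) (lift (Lam \<sigma> u) \<cdot> Var 0)"
    by (rule conv_trans[OF beta conv_trans[OF assms conv_sym[OF beta]]])
      (use assms in \<open>auto dest: conv_infer\<close>)
qed (use assms in \<open>auto dest: conv_infer\<close>)

lemma conv_if_tt:
  assumes "infer \<Gamma> t = Some X" "infer \<Gamma> u = Some X"
  shows "conv \<Gamma> \<Phi> X (if_tm X tt t u) t"
  using assms by (simp add: conv_def typing_iff_infer Ax if_true)

lemma conv_if_ff:
  assumes "infer \<Gamma> t = Some X" "infer \<Gamma> u = Some X"
  shows "conv \<Gamma> \<Phi> X (if_tm X ff t u) u"
  using assms by (simp add: conv_def typing_iff_infer Ax if_false)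

lemma conv_if:
  assumes "conv \<Gamma> \<Phi> Bool b b'" "conv \<Gamma> \<Phi> X t t'" "conv \<Gamma> \<Phi> X u u'"
  shows "conv \<Gamma> \<Phi> X (if_tm X b t u) (if_tm X b' t' u')"
  by (rule conv_app conv_refl assms | simp)+

lemma conv_if_cond:
  assumes "conv \<Gamma> \<Phi> Bool b b'" "infer \<Gamma> t = Some X" "infer \<Gamma> u = Some X"
  shows "conv \<Gamma> \<Phi> X (if_tm X b t u) (if_tm X b' t u)"
  by (intro conv_if conv_refl assms)


section \<open>Induction on equations\<close>

lemma conv_bool_cases:
  assumes "infer (Bool # \<Gamma>) t = Some \<tau>" "infer (Bool # \<Gamma>) u = Some \<tau>"
    and "conv \<Gamma> \<Phi> \<tau> (subst (inst tt) t) (subst (inst tt) u)"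
    and "conv \<Gamma> \<Phi> \<tau> (subst (inst ff) t) (subst (inst ff) u)"
    and b: "infer \<Gamma> b = Some Bool"
  shows "conv \<Gamma> \<Phi> \<tau> (subst (inst b) t) (subst (inst b) u)"
proof -
  have "derives HA_omega \<Gamma> \<Phi> (All Bool (Eq \<tau> t u))"
    using ImpE[OF ImpE[OF Ax[of HA_omega, OF bool_cases[of \<Gamma> "Eq \<tau> t u"]]]] assms
    by (simp add: conv_def typing_iff_infer)
  from AllE[OF this, of b] b assms(1,2) show ?thesis
    by (simp add: conv_def typing_iff_infer infer_subst_inst[where \<sigma> = Bool])
qed

lemma conv_AllE:
  assumes "derives HA_omega \<Gamma> \<Phi> (All \<sigma> (Eq \<tau> t u))" "infer \<Gamma> a = Some \<sigma>"
    and "infer (\<sigma> # \<Gamma>) t = Some \<tau>" "infer (\<sigma> # \<Gamma>) u = Some \<tau>"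
  shows "conv \<Gamma> \<Phi> \<tau> (subst (inst a) t) (subst (inst a) u)"
  using AllE[OF assms(1), of a] assms
  by (simp add: conv_def typing_iff_infer infer_subst_inst[where \<sigma> = \<sigma>])

lemma derives_nat_induct:
  assumes "wff (Nat # \<Gamma>) \<phi>" "derives HA_omega \<Gamma> \<Phi> (fsubst (inst zero_tm) \<phi>)"
    and "derives HA_omega (Nat # \<Gamma>) (\<phi> # map flift \<Phi>) (fsubst (repl 1 (suc_tm (Var 0))) \<phi>)"
  shows "derives HA_omega \<Gamma> \<Phi> (All Nat \<phi>)"
  by (rule ImpE[OF ImpE[OF Ax[of HA_omega, OF nat_induct] _] AllI[OF ImpI]]) (use assms in auto)

text \<open>The step adds two variables, head and tail, so \<open>repl 2\<close> moves the induction
  formula to the larger context. The second premise is the well-formedness of the induction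
  hypothesis, which \<open>ImpI\<close> asks for.\<close>

lemma derives_seq_induct:
  assumes "wff (Seq X # \<Gamma>) \<phi>" "wff (Seq X # X # \<Gamma>) (fsubst (repl 2 (Var 0)) \<phi>)"
    and "derives HA_omega \<Gamma> \<Phi> (fsubst (inst (nil_tm X)) \<phi>)"
    and "derives HA_omega (Seq X # X # \<Gamma>)
      (fsubst (repl 2 (Var 0)) \<phi> # map flift (map flift \<Phi>))
      (fsubst (repl 2 (cons_tm X (Var 1) (Var 0))) \<phi>)"
  shows "derives HA_omega \<Gamma> \<Phi> (All (Seq X) \<phi>)"
  by (rule ImpE[OF ImpE[OF Ax[of HA_omega, OF seq_induct] _] AllI[OF AllI[OF ImpI]]])
    (use assms in auto)


section \<open>Operations on sequences\<close>

lemma subst_less_fun [simp]: "subst \<theta> less_fun = less_fun" "rename \<rho> less_fun = less_fun"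
  by (simp_all add: less_fun_def)

lemma subst_len_fun [simp]: "subst \<theta> (len_fun X) = len_fun X" "rename \<rho> (len_fun X) = len_fun X"
  by (simp_all add: len_fun_def)

lemma subst_append_fun [simp]:
  "subst \<theta> (append_fun X) = append_fun X" "rename \<rho> (append_fun X) = append_fun X"
  by (simp_all add: append_fun_def)

lemma subst_conc_fun [simp]:
  "subst \<theta> (conc_fun X) = conc_fun X" "rename \<rho> (conc_fun X) = conc_fun X"
  by (simp_all add: conc_fun_def)

lemma subst_overwrite_fun [simp]:
  "subst \<theta> (overwrite_fun X) = overwrite_fun X" "rename \<rho> (overwrite_fun X) = overwrite_fun X"
  by (simp_all add: overwrite_fun_def)

lemma infer_funs [simp]:
  "infer \<Gamma> less_fun = Some (Nat \<rightarrow> Nat \<rightarrow> Bool)"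
  "infer \<Gamma> (len_fun X) = Some (Seq X \<rightarrow> Nat)"
  "infer \<Gamma> (append_fun X) = Some (Seq X \<rightarrow> Seq X \<rightarrow> Seq X)"
  "infer \<Gamma> (conc_fun X) = Some (Seq X \<rightarrow> Stream X \<rightarrow> Stream X)"
  by (simp_all add: less_fun_def len_fun_def append_fun_def conc_fun_def)

lemma infer_overwrite_fun [simp]:
  "infer \<Gamma> (overwrite_fun X) = Some (Seq X \<rightarrow> Stream X \<rightarrow> Stream X)"
  by (simp add: overwrite_fun_def)

lemma subst_shift [simp]: "subst \<theta> (shift X q x) = shift X (subst \<theta> q) (subst \<theta> x)"
  by (simp add: shift_def)

lemma infer_shift [simp]:
  assumes "infer \<Gamma> q = Some (Stream X \<rightarrow> R)" "infer \<Gamma> x = Some X"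
  shows "infer \<Gamma> (shift X q x) = Some (Stream X \<rightarrow> R)"
  using assms by (simp add: shift_def)

section \<open>Computation rules of the recursors\<close>

lemma conv_rec_zero:
  assumes "infer \<Gamma> a = Some X" "infer \<Gamma> f = Some (Nat \<rightarrow> X \<rightarrow> X)"
  shows "conv \<Gamma> \<Phi> X (nrec_tm X a f zero_tm) a"
  using assms by (simp add: conv_def typing_iff_infer Ax rec_zero)

lemma conv_rec_suc:
  assumes "infer \<Gamma> a = Some X" "infer \<Gamma> f = Some (Nat \<rightarrow> X \<rightarrow> X)" "infer \<Gamma> n = Some Nat"
  shows "conv \<Gamma> \<Phi> X (nrec_tm X a f (suc_tm n)) (f \<cdot> n \<cdot> nrec_tm X a f n)"
  using assms by (simp add: conv_def typing_iff_infer Ax rec_suc)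

lemma conv_srec_nil:
  assumes "infer \<Gamma> a = Some Y" "infer \<Gamma> f = Some (X \<rightarrow> Seq X \<rightarrow> Y \<rightarrow> Y)"
  shows "conv \<Gamma> \<Phi> Y (srec_tm X Y a f (nil_tm X)) a"
  using assms by (simp add: conv_def typing_iff_infer Ax srec_nil)

lemma conv_srec_cons:
  assumes "infer \<Gamma> a = Some Y" "infer \<Gamma> f = Some (X \<rightarrow> Seq X \<rightarrow> Y \<rightarrow> Y)"
    and "infer \<Gamma> x = Some X" "infer \<Gamma> s = Some (Seq X)"
  shows "conv \<Gamma> \<Phi> Y (srec_tm X Y a f (cons_tm X x s)) (f \<cdot> x \<cdot> s \<cdot> srec_tm X Y a f s)"
  using assms by (simp add: conv_def typing_iff_infer Ax srec_cons)

section \<open>Comparison of numbers\<close>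

definition less_step :: tm where
  "less_step = Lam Nat (Lam (Nat \<rightarrow> Bool) (Lam Nat
     (nrec_tm Bool tt (Lam Nat (Lam Bool (Var 3 \<cdot> Var 1))) (Var 0))))"

abbreviation less_rec :: "tm \<Rightarrow> tm" where
  "less_rec n \<equiv> nrec_tm (Nat \<rightarrow> Bool) (Lam Nat ff) less_step n"

lemma infer_less_step [simp]: "infer \<Gamma> less_step = Some (Nat \<rightarrow> (Nat \<rightarrow> Bool) \<rightarrow> Nat \<rightarrow> Bool)"
  by (simp add: less_step_def)

lemma subst_less_step [simp]: "subst \<theta> less_step = less_step" "rename \<rho> less_step = less_step"
  by (simp_all add: less_step_def)

text \<open>With its step named, the recursion stays folded during beta reduction, because
  substitution leaves the closed term \<open>less_step\<close> alone. \<open>append_step\<close> and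
  \<open>conc_step\<close> serve the same purpose.\<close>

lemma less_fun_rec: "less_fun = Lam Nat (Lam Nat (less_rec (Var 0) \<cdot> Var 1))"
  by (simp add: less_fun_def less_step_def)

lemma conv_less_rec:
  assumes "infer \<Gamma> m = Some Nat" "infer \<Gamma> n = Some Nat"
  shows "conv \<Gamma> \<Phi> Bool (less m n) (less_rec n \<cdot> m)"
  using conv_beta2[of Nat Nat \<Gamma> "less_rec (Var 0) \<cdot> Var 1" Bool m n \<Phi>] assms
  by (simp add: less_fun_rec)

text \<open>The main recursion runs over the second argument and yields a predicate of the first.
  The inner recursion is a case distinction on \<open>m\<close>: zero gives true, and a successor
  passes its predecessor, \<open>Var 1\<close>, to the predicate for \<open>n\<close>.\<close>

lemma conv_less_rec_suc:
  assumes "infer \<Gamma> m = Some Nat" "infer \<Gamma> n = Some Nat"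
  shows "conv \<Gamma> \<Phi> Bool (less_rec (suc_tm n) \<cdot> m)
    (nrec_tm Bool tt (Lam Nat (Lam Bool (lift (lift (less_rec n)) \<cdot> Var 1))) m)"
proof -
  have "conv \<Gamma> \<Phi> Bool (less_rec (suc_tm n) \<cdot> m) (less_step \<cdot> n \<cdot> less_rec n \<cdot> m)"
    by (rule conv_fun[OF conv_rec_suc]) (use assms in simp_all)
  also have "conv \<Gamma> \<Phi> Bool \<dots>
      (nrec_tm Bool tt (Lam Nat (Lam Bool (lift (lift (less_rec n)) \<cdot> Var 1))) m)"
    using conv_beta3[of Nat "Nat \<rightarrow> Bool" Nat \<Gamma>
        "nrec_tm Bool tt (Lam Nat (Lam Bool (Var 3 \<cdot> Var 1))) (Var 0)" Bool n "less_rec n" m \<Phi>] assms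
    by (simp add: less_step_def numeral_eq_Suc)
  finally show ?thesis .
qed

lemma conv_less_zero:
  assumes "infer \<Gamma> m = Some Nat"
  shows "conv \<Gamma> \<Phi> Bool (less m zero_tm) ff"
proof -
  have "conv \<Gamma> \<Phi> Bool (less m zero_tm) (less_rec zero_tm \<cdot> m)"
    by (rule conv_less_rec) (use assms in simp_all)
  also have "conv \<Gamma> \<Phi> Bool \<dots> (Lam Nat ff \<cdot> m)"
    by (rule conv_fun[OF conv_rec_zero]) (use assms in simp_all)
  also have "conv \<Gamma> \<Phi> Bool \<dots> ff"
    using conv_beta[of Nat \<Gamma> ff Bool m \<Phi>] assms by simp
  finally show ?thesis .
qed

lemma conv_less_zero_suc:
  assumes "infer \<Gamma> n = Some Nat"
  shows "conv \<Gamma> \<Phi> Bool (less zero_tm (suc_tm n)) tt"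
  by (rule conv_trans[OF conv_less_rec conv_trans[OF conv_less_rec_suc conv_rec_zero]])
    (use assms in simp_all)

lemma conv_less_suc_suc:
  assumes "infer \<Gamma> m = Some Nat" "infer \<Gamma> n = Some Nat"
  shows "conv \<Gamma> \<Phi> Bool (less (suc_tm m) (suc_tm n)) (less m n)"
proof -
  let ?f = "Lam Nat (Lam Bool (lift (lift (less_rec n)) \<cdot> Var 1))"
  have "conv \<Gamma> \<Phi> Bool (less (suc_tm m) (suc_tm n)) (?f \<cdot> m \<cdot> nrec_tm Bool tt ?f m)"
    by (rule conv_trans[OF conv_less_rec conv_trans[OF conv_less_rec_suc conv_rec_suc]])
      (use assms in simp_all)
  also have "conv \<Gamma> \<Phi> Bool \<dots> (less_rec n \<cdot> m)"
    using conv_beta2[of Bool Nat \<Gamma> "lift (lift (less_rec n)) \<cdot> Var 1" Bool m "nrec_tm Bool tt ?f m" \<Phi>]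
      assms by simp
  also have "conv \<Gamma> \<Phi> Bool \<dots> (less m n)"
    by (rule conv_sym[OF conv_less_rec]) (use assms in simp_all)
  finally show ?thesis .
qed

section \<open>Length of finite sequences\<close>

lemma conv_len_srec:
  assumes "infer \<Gamma> s = Some (Seq X)"
  shows "conv \<Gamma> \<Phi> Nat (len X s)
    (srec_tm X Nat zero_tm (Lam X (Lam (Seq X) (Lam Nat (suc_tm (Var 0))))) s)"
  using conv_beta[of "Seq X" \<Gamma>
      "srec_tm X Nat zero_tm (Lam X (Lam (Seq X) (Lam Nat (suc_tm (Var 0))))) (Var 0)" Nat s \<Phi>] assms
  by (simp add: len_fun_def)

lemma conv_len_nil: "conv \<Gamma> \<Phi> Nat (len X (nil_tm X)) zero_tm"
  by (rule conv_trans[OF conv_len_srec conv_srec_nil]) simp_all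

lemma conv_len_cons:
  assumes "infer \<Gamma> x = Some X" "infer \<Gamma> s = Some (Seq X)"
  shows "conv \<Gamma> \<Phi> Nat (len X (cons_tm X x s)) (suc_tm (len X s))"
proof -
  let ?f = "Lam X (Lam (Seq X) (Lam Nat (suc_tm (Var 0))))"
  have "conv \<Gamma> \<Phi> Nat (len X (cons_tm X x s)) (?f \<cdot> x \<cdot> s \<cdot> srec_tm X Nat zero_tm ?f s)"
    by (rule conv_trans[OF conv_len_srec conv_srec_cons]) (use assms in simp_all)
  also have "conv \<Gamma> \<Phi> Nat \<dots> (suc_tm (srec_tm X Nat zero_tm ?f s))"
    using conv_beta3[of Nat "Seq X" X \<Gamma> "suc_tm (Var 0)" Nat x s "srec_tm X Nat zero_tm ?f s" \<Phi>] assms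
    by simp
  also have "conv \<Gamma> \<Phi> Nat \<dots> (suc_tm (len X s))"
    by (rule conv_arg[OF conv_sym[OF conv_len_srec]]) (use assms in simp_all)
  finally show ?thesis .
qed

section \<open>Concatenation of finite sequences\<close>

definition append_step :: "ty \<Rightarrow> tm" where
  "append_step X = Lam X (Lam (Seq X) (Lam (Seq X) (cons_tm X (Var 2) (Var 0))))"

lemma infer_append_step [simp]:
  "infer \<Gamma> (append_step X) = Some (X \<rightarrow> Seq X \<rightarrow> Seq X \<rightarrow> Seq X)"
  by (simp add: append_step_def)

lemma subst_append_step [simp]: "subst \<theta> (append_step X) = append_step X"
  by (simp add: append_step_def)

lemma append_fun_srec:
  "append_fun X = Lam (Seq X) (Lam (Seq X) (srec_tm X (Seq X) (Var 0) (append_step X) (Var 1)))"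
  by (simp add: append_fun_def append_step_def)

lemma conv_append_srec:
  assumes "infer \<Gamma> s = Some (Seq X)" "infer \<Gamma> t = Some (Seq X)"
  shows "conv \<Gamma> \<Phi> (Seq X) (append X s t) (srec_tm X (Seq X) t (append_step X) s)"
  using conv_beta2[of "Seq X" "Seq X" \<Gamma> "srec_tm X (Seq X) (Var 0) (append_step X) (Var 1)" "Seq X" s t \<Phi>]
    assms
  by (simp add: append_fun_srec)

lemma conv_append_nil:
  assumes "infer \<Gamma> t = Some (Seq X)"
  shows "conv \<Gamma> \<Phi> (Seq X) (append X (nil_tm X) t) t"
  by (rule conv_trans[OF conv_append_srec conv_srec_nil]) (use assms in simp_all)

lemma conv_append_cons:
  assumes "infer \<Gamma> x = Some X" "infer \<Gamma> s = Some (Seq X)" "infer \<Gamma> t = Some (Seq X)"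
  shows "conv \<Gamma> \<Phi> (Seq X) (append X (cons_tm X x s) t) (cons_tm X x (append X s t))"
proof -
  let ?r = "srec_tm X (Seq X) t (append_step X) s"
  have "conv \<Gamma> \<Phi> (Seq X) (append X (cons_tm X x s) t) (append_step X \<cdot> x \<cdot> s \<cdot> ?r)"
    by (rule conv_trans[OF conv_append_srec conv_srec_cons]) (use assms in simp_all)
  also have "conv \<Gamma> \<Phi> (Seq X) \<dots> (cons_tm X x ?r)"
    using conv_beta3[of "Seq X" "Seq X" X \<Gamma> "cons_tm X (Var 2) (Var 0)" "Seq X" x s ?r \<Phi>] assms
    by (simp add: append_step_def[symmetric])
  also have "conv \<Gamma> \<Phi> (Seq X) \<dots> (cons_tm X x (append X s t))"
    by (rule conv_arg[OF conv_sym[OF conv_append_srec]]) (use assms in simp_all)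
  finally show ?thesis .
qed

section \<open>Concatenation of a finite and an infinite sequence\<close>

definition conc_step :: "ty \<Rightarrow> tm" where
  "conc_step X = Lam X (Lam (Seq X) (Lam (Stream X) (Lam Nat
     (nrec_tm X (Var 3) (Lam Nat (Lam X (Var 3 \<cdot> Var 1))) (Var 0)))))"

lemma infer_conc_step [simp]:
  "infer \<Gamma> (conc_step X) = Some (X \<rightarrow> Seq X \<rightarrow> Stream X \<rightarrow> Stream X)"
  by (simp add: conc_step_def)

lemma subst_conc_step [simp]: "subst \<theta> (conc_step X) = conc_step X"
  by (simp add: conc_step_def)

text \<open>The reduct does not mention \<open>s\<close>. Hence the tail argument of the step may be
  exchanged, which \<open>conv_conc_append\<close> exploits.\<close>

lemma conv_conc_step:
  assumes "infer \<Gamma> x = Some X" "infer \<Gamma> s = Some (Seq X)" "infer \<Gamma> r = Some (Stream X)"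
  shows "conv \<Gamma> \<Phi> (Stream X) (conc_step X \<cdot> x \<cdot> s \<cdot> r)
    (Lam Nat (nrec_tm X (lift x) (Lam Nat (Lam X (lift (lift (lift r)) \<cdot> Var 1))) (Var 0)))"
  using conv_beta3[of "Stream X" "Seq X" X \<Gamma>
      "Lam Nat (nrec_tm X (Var 3) (Lam Nat (Lam X (Var 3 \<cdot> Var 1))) (Var 0))" "Stream X" x s r \<Phi>] assms
  by (simp add: conc_step_def)

lemma conv_conc_step_app:
  assumes "infer \<Gamma> x = Some X" "infer \<Gamma> s = Some (Seq X)" "infer \<Gamma> r = Some (Stream X)"
    and "infer \<Gamma> n = Some Nat"
  shows "conv \<Gamma> \<Phi> X (conc_step X \<cdot> x \<cdot> s \<cdot> r \<cdot> n)
    (nrec_tm X x (Lam Nat (Lam X (lift (lift r) \<cdot> Var 1))) n)"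
  using conv_beta4[of Nat "Stream X" "Seq X" X \<Gamma>
      "nrec_tm X (Var 3) (Lam Nat (Lam X (Var 3 \<cdot> Var 1))) (Var 0)" X x s r n \<Phi>] assms
  by (simp add: conc_step_def)

lemma conc_fun_srec:
  "conc_fun X = Lam (Seq X) (Lam (Stream X) (srec_tm X (Stream X) (Var 0) (conc_step X) (Var 1)))"
  by (simp add: conc_fun_def conc_step_def)

lemma conv_conc_srec:
  assumes "infer \<Gamma> s = Some (Seq X)" "infer \<Gamma> \<alpha> = Some (Stream X)"
  shows "conv \<Gamma> \<Phi> (Stream X) (conc X s \<alpha>) (srec_tm X (Stream X) \<alpha> (conc_step X) s)"
  using conv_beta2[of "Stream X" "Seq X" \<Gamma> "srec_tm X (Stream X) (Var 0) (conc_step X) (Var 1)"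
      "Stream X" s \<alpha> \<Phi>] assms
  by (simp add: conc_fun_srec)

lemma conv_conc_nil:
  assumes "infer \<Gamma> \<alpha> = Some (Stream X)"
  shows "conv \<Gamma> \<Phi> (Stream X) (conc X (nil_tm X) \<alpha>) \<alpha>"
  by (rule conv_trans[OF conv_conc_srec conv_srec_nil]) (use assms in simp_all)

lemma conv_conc_cons:
  assumes "infer \<Gamma> x = Some X" "infer \<Gamma> s = Some (Seq X)" "infer \<Gamma> \<alpha> = Some (Stream X)"
  shows "conv \<Gamma> \<Phi> (Stream X) (conc X (cons_tm X x s) \<alpha>) (conc_step X \<cdot> x \<cdot> s \<cdot> conc X s \<alpha>)"
proof -
  have "conv \<Gamma> \<Phi> (Stream X) (conc X (cons_tm X x s) \<alpha>)
      (conc_step X \<cdot> x \<cdot> s \<cdot> srec_tm X (Stream X) \<alpha> (conc_step X) s)"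
    by (rule conv_trans[OF conv_conc_srec conv_srec_cons]) (use assms in simp_all)
  also have "conv \<Gamma> \<Phi> (Stream X) \<dots> (conc_step X \<cdot> x \<cdot> s \<cdot> conc X s \<alpha>)"
    by (rule conv_arg[OF conv_sym[OF conv_conc_srec]]) (use assms in simp_all)
  finally show ?thesis .
qed

lemma conv_conc_cons_zero:
  assumes "infer \<Gamma> x = Some X" "infer \<Gamma> s = Some (Seq X)" "infer \<Gamma> \<alpha> = Some (Stream X)"
  shows "conv \<Gamma> \<Phi> X (conc X (cons_tm X x s) \<alpha> \<cdot> zero_tm) x"
  by (rule conv_trans[OF conv_fun[OF conv_conc_cons] conv_trans[OF conv_conc_step_app conv_rec_zero]])
    (use assms in simp_all)

lemma conv_conc_cons_suc:
  assumes "infer \<Gamma> x = Some X" "infer \<Gamma> s = Some (Seq X)" "infer \<Gamma> \<alpha> = Some (Stream X)"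
    and "infer \<Gamma> n = Some Nat"
  shows "conv \<Gamma> \<Phi> X (conc X (cons_tm X x s) \<alpha> \<cdot> suc_tm n) (conc X s \<alpha> \<cdot> n)"
proof -
  let ?f = "Lam Nat (Lam X (lift (lift (conc X s \<alpha>)) \<cdot> Var 1))"
  have "conv \<Gamma> \<Phi> X (conc X (cons_tm X x s) \<alpha> \<cdot> suc_tm n) (?f \<cdot> n \<cdot> nrec_tm X x ?f n)"
    by (rule conv_trans[OF conv_fun[OF conv_conc_cons] conv_trans[OF conv_conc_step_app conv_rec_suc]])
      (use assms in simp_all)
  also have "conv \<Gamma> \<Phi> X \<dots> (conc X s \<alpha> \<cdot> n)"
    using conv_beta2[of X Nat \<Gamma> "lift (lift (conc X s \<alpha>)) \<cdot> Var 1" X n "nrec_tm X x ?f n" \<Phi>] assms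
    by simp
  finally show ?thesis .
qed

text \<open>Induction on \<open>s\<close>. For a nonempty sequence both sides unfold to
  \<open>conc_step\<close> with the same head and equal results of recursion; this gives equality of
  streams without looking at entries.\<close>

lemma conv_conc_append:
  assumes "infer \<Gamma> s = Some (Seq X)" "infer \<Gamma> t = Some (Seq X)" "infer \<Gamma> \<alpha> = Some (Stream X)"
  shows "conv \<Gamma> \<Phi> (Stream X) (conc X (append X s t) \<alpha>) (conc X s (conc X t \<alpha>))"
proof -
  let ?\<phi> = "Eq (Stream X) (conc X (append X (Var 0) (lift t)) (lift \<alpha>))
    (conc X (Var 0) (conc X (lift t) (lift \<alpha>)))"
  have nil: "conv \<Gamma> \<Phi> (Stream X) (conc X (append X (nil_tm X) t) \<alpha>) (conc X (nil_tm X) (conc X t \<alpha>))"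
  proof -
    have "conv \<Gamma> \<Phi> (Stream X) (conc X (append X (nil_tm X) t) \<alpha>) (conc X t \<alpha>)"
      by (rule conv_fun[OF conv_arg[OF conv_append_nil]]) (use assms in simp_all)
    also have "conv \<Gamma> \<Phi> (Stream X) \<dots> (conc X (nil_tm X) (conc X t \<alpha>))"
      by (rule conv_sym[OF conv_conc_nil]) (use assms in simp_all)
    finally show ?thesis .
  qed
  \<comment> \<open>Stated for any context, because it is applied where head and tail are new
    variables and \<open>t\<close> and \<open>\<alpha>\<close> have been lifted twice.\<close>
  have cons: "conv \<Delta> \<Psi> (Stream X) (conc X (append X (cons_tm X x s) t) \<alpha>)
      (conc X (cons_tm X x s) (conc X t \<alpha>))"
    if IH: "conv \<Delta> \<Psi> (Stream X) (conc X (append X s t) \<alpha>) (conc X s (conc X t \<alpha>))"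
      and ty: "infer \<Delta> x = Some X" "infer \<Delta> s = Some (Seq X)" "infer \<Delta> t = Some (Seq X)"
        "infer \<Delta> \<alpha> = Some (Stream X)" for \<Delta> \<Psi> x s t \<alpha>
  proof -
    let ?r = "conc X (append X s t) \<alpha>"
    have "conv \<Delta> \<Psi> (Stream X) (conc X (append X (cons_tm X x s) t) \<alpha>)
        (conc X (cons_tm X x (append X s t)) \<alpha>)"
      by (rule conv_fun[OF conv_arg[OF conv_append_cons]]) (use ty in simp_all)
    also have "conv \<Delta> \<Psi> (Stream X) \<dots> (conc_step X \<cdot> x \<cdot> append X s t \<cdot> ?r)"
      by (rule conv_conc_cons) (use ty in simp_all)
    \<comment> \<open>The tails \<open>append X s t\<close> and \<open>s\<close> differ, but both
      terms reduce to the same abstraction.\<close>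
    also have "conv \<Delta> \<Psi> (Stream X) \<dots> (conc_step X \<cdot> x \<cdot> s \<cdot> ?r)"
      by (rule conv_trans[OF conv_conc_step conv_sym[OF conv_conc_step]]) (use ty in simp_all)
    also have "conv \<Delta> \<Psi> (Stream X) \<dots> (conc_step X \<cdot> x \<cdot> s \<cdot> conc X s (conc X t \<alpha>))"
      by (rule conv_arg[OF IH]) (use ty in simp_all)
    also have "conv \<Delta> \<Psi> (Stream X) \<dots> (conc X (cons_tm X x s) (conc X t \<alpha>))"
      by (rule conv_sym[OF conv_conc_cons]) (use ty in simp_all)
    finally show ?thesis .
  qed
  have "derives HA_omega \<Gamma> \<Phi> (All (Seq X) ?\<phi>)"
  proof (rule derives_seq_induct)
    show "derives HA_omega \<Gamma> \<Phi> (fsubst (inst (nil_tm X)) ?\<phi>)"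
      using conv_derives[OF nil] by simp
    let ?\<Psi> = "fsubst (repl 2 (Var 0)) ?\<phi> # map flift (map flift \<Phi>)"
    have "conv (Seq X # X # \<Gamma>) ?\<Psi> (Stream X)
        (conc X (append X (Var 0) (lift (lift t))) (lift (lift \<alpha>)))
        (conc X (Var 0) (conc X (lift (lift t)) (lift (lift \<alpha>))))"
      using assms by (simp add: conv_def Hyp)
    from cons[OF this, of "Var 1"] assms
    show "derives HA_omega (Seq X # X # \<Gamma>) ?\<Psi> (fsubst (repl 2 (cons_tm X (Var 1) (Var 0))) ?\<phi>)"
      by (simp add: conv_def)
  qed (use assms in \<open>simp_all add: typing_iff_infer\<close>)
  from conv_AllE[OF this assms(1)] assms show ?thesis by simp
qed

section \<open>Case distinction on whether a position lies inside a finite sequence\<close>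

lemma conv_if_less_len_nil:
  assumes "infer \<Gamma> n = Some Nat" "infer \<Gamma> u = Some Y" "infer \<Gamma> v = Some Y"
  shows "conv \<Gamma> \<Phi> Y (if_tm Y (less n (len X (nil_tm X))) u v) v"
proof -
  have "conv \<Gamma> \<Phi> Bool (less n (len X (nil_tm X))) ff"
    by (rule conv_trans[OF conv_arg[OF conv_len_nil] conv_less_zero]) (use assms in simp_all)
  from conv_trans[OF conv_if_cond[OF this] conv_if_ff] assms show ?thesis by simp
qed

lemma conv_if_less_len_cons_zero:
  assumes "infer \<Gamma> x = Some X" "infer \<Gamma> s = Some (Seq X)" "infer \<Gamma> u = Some Y" "infer \<Gamma> v = Some Y"
  shows "conv \<Gamma> \<Phi> Y (if_tm Y (less zero_tm (len X (cons_tm X x s))) u v) u"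
proof -
  have "conv \<Gamma> \<Phi> Bool (less zero_tm (len X (cons_tm X x s))) tt"
    by (rule conv_trans[OF conv_arg[OF conv_len_cons] conv_less_zero_suc]) (use assms in simp_all)
  from conv_trans[OF conv_if_cond[OF this] conv_if_tt] assms show ?thesis by simp
qed

lemma conv_less_suc_len_cons:
  assumes "infer \<Gamma> n = Some Nat" "infer \<Gamma> x = Some X" "infer \<Gamma> s = Some (Seq X)"
  shows "conv \<Gamma> \<Phi> Bool (less (suc_tm n) (len X (cons_tm X x s))) (less n (len X s))"
  by (rule conv_trans[OF conv_arg[OF conv_len_cons] conv_less_suc_suc]) (use assms in simp_all)

text \<open>\<open>D s i \<alpha>\<close> is the entry used beyond the end of \<open>s\<close>: either \<open>(s * \<alpha>)(i)\<close> or zero.\<close>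

lemma conv_if_less_len:
  fixes D :: "tm \<Rightarrow> tm \<Rightarrow> tm \<Rightarrow> tm"
  assumes subst_D: "\<And>\<theta> s n \<alpha>. subst \<theta> (D s n \<alpha>) = D (subst \<theta> s) (subst \<theta> n) (subst \<theta> \<alpha>)"
    and infer_D: "\<And>\<Delta> s n \<alpha>. infer \<Delta> s = Some (Seq X) \<Longrightarrow> infer \<Delta> n = Some Nat \<Longrightarrow>
      infer \<Delta> \<alpha> = Some (Stream X) \<Longrightarrow> infer \<Delta> (D s n \<alpha>) = Some X"
    and nil: "\<And>\<Psi>. conv (Nat # \<Gamma>) \<Psi> X (D (nil_tm X) (Var 0) (lift \<alpha>)) (lift \<alpha> \<cdot> Var 0)"
    and cons: "\<And>\<Delta> \<Psi> x s n \<alpha>. infer \<Delta> x = Some X \<Longrightarrow> infer \<Delta> s = Some (Seq X) \<Longrightarrow>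
      infer \<Delta> n = Some Nat \<Longrightarrow> infer \<Delta> \<alpha> = Some (Stream X) \<Longrightarrow>
      conv \<Delta> \<Psi> X (D (cons_tm X x s) (suc_tm n) \<alpha>) (D s n \<alpha>)"
    and \<alpha>: "infer \<Gamma> \<alpha> = Some (Stream X)" and \<beta>: "infer \<Gamma> \<beta> = Some (Stream X)"
    and s: "infer \<Gamma> s = Some (Seq X)" and n: "infer \<Gamma> n = Some Nat"
  shows "conv \<Gamma> \<Phi> X (if_tm X (less n (len X s)) (conc X s \<beta> \<cdot> n) (D s n \<alpha>)) (conc X s \<alpha> \<cdot> n)"
proof -
  let ?L = "\<lambda>s n \<alpha> \<beta>. if_tm X (less n (len X s)) (conc X s \<beta> \<cdot> n) (D s n \<alpha>)"
  let ?eq = "\<lambda>s n \<alpha> \<beta>. Eq X (?L s n \<alpha> \<beta>) (conc X s \<alpha> \<cdot> n)"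
  \<comment> \<open>The position is quantified inside the induction formula, since the case of a
    longer sequence uses the hypothesis at the preceding position.\<close>
  let ?\<phi> = "All Nat (?eq (Var 1) (Var 0) (lift (lift \<alpha>)) (lift (lift \<beta>)))"
  have "derives HA_omega \<Gamma> \<Phi> (All (Seq X) ?\<phi>)"
  proof (rule derives_seq_induct)
    have "conv (Nat # \<Gamma>) \<Psi> X (?L (nil_tm X) (Var 0) (lift \<alpha>) (lift \<beta>))
        (conc X (nil_tm X) (lift \<alpha>) \<cdot> Var 0)" for \<Psi>
      by (rule conv_trans[OF conv_if_less_len_nil conv_trans[OF nil conv_fun[OF conv_sym[OF conv_conc_nil]]]])
        (use \<alpha> \<beta> in \<open>simp_all add: infer_D\<close>)
    from AllI[OF conv_derives[OF this]]
    show "derives HA_omega \<Gamma> \<Phi> (fsubst (inst (nil_tm X)) ?\<phi>)"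
      by (simp add: subst_D)
    let ?\<Delta> = "Seq X # X # \<Gamma>" and ?\<Psi> = "fsubst (repl 2 (Var 0)) ?\<phi> # map flift (map flift \<Phi>)"
    let ?\<alpha> = "lift (lift (lift \<alpha>))" and ?\<beta> = "lift (lift (lift \<beta>))"
    let ?c = "cons_tm X (Var 2) (Var 1)"
    let ?\<psi> = "?eq ?c (Var 0) ?\<alpha> ?\<beta>"
    have "derives HA_omega ?\<Delta> ?\<Psi> (All Nat ?\<psi>)"
    \<comment> \<open>Induction on the position acts as a case distinction between zero and
      successor; the equation at the predecessor comes from the outer induction over
      sequences.\<close>
    proof (rule derives_nat_induct)
      \<comment> \<open>At position zero no position variable is bound, so head and tail have
        indices 1 and 0 instead of 2 and 1.\<close>
      let ?c = "cons_tm X (Var 1) (Var 0)"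
      have "conv ?\<Delta> ?\<Psi> X (?L ?c zero_tm (lift (lift \<alpha>)) (lift (lift \<beta>))) (Var 1)"
        by (rule conv_trans[OF conv_if_less_len_cons_zero conv_conc_cons_zero])
          (use \<alpha> \<beta> in \<open>simp_all add: infer_D\<close>)
      also have "conv ?\<Delta> ?\<Psi> X \<dots> (conc X ?c (lift (lift \<alpha>)) \<cdot> zero_tm)"
        by (rule conv_sym[OF conv_conc_cons_zero]) (use \<alpha> in simp_all)
      finally show "derives HA_omega ?\<Delta> ?\<Psi> (fsubst (inst zero_tm) ?\<psi>)"
        by (simp add: conv_def subst_D)
    next
      let ?\<Omega> = "?\<psi> # map flift ?\<Psi>"
      have "conv (Nat # ?\<Delta>) ?\<Omega> X (?L ?c (suc_tm (Var 0)) ?\<alpha> ?\<beta>) (?L (Var 1) (Var 0) ?\<alpha> ?\<beta>)"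
        by (rule conv_if[OF conv_less_suc_len_cons conv_conc_cons_suc cons])
          (use \<alpha> \<beta> in \<open>simp_all add: infer_D\<close>)
      also have "conv (Nat # ?\<Delta>) ?\<Omega> X \<dots> (conc X (Var 1) ?\<alpha> \<cdot> Var 0)"
      proof -
        \<comment> \<open>The outer hypothesis, lifted past the position variable: below its own
          quantifier the tail now has index 2.\<close>
        have "derives HA_omega (Nat # ?\<Delta>) ?\<Omega> (All Nat (?eq (Var 2) (Var 0) (lift ?\<alpha>) (lift ?\<beta>)))"
          by (rule Hyp) (simp add: subst_D numeral_eq_Suc)
        from conv_AllE[OF this, of "Var 0"] \<alpha> \<beta> show ?thesis
          by (simp add: subst_D infer_D)
      qed
      also have "conv (Nat # ?\<Delta>) ?\<Omega> X \<dots> (conc X ?c ?\<alpha> \<cdot> suc_tm (Var 0))"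
        by (rule conv_sym[OF conv_conc_cons_suc]) (use \<alpha> in simp_all)
      finally show "derives HA_omega (Nat # ?\<Delta>) ?\<Omega> (fsubst (repl 1 (suc_tm (Var 0))) ?\<psi>)"
        by (simp add: conv_def subst_D numeral_eq_Suc)
    qed (use \<alpha> \<beta> in \<open>simp add: typing_iff_infer infer_D\<close>)
    then show "derives HA_omega ?\<Delta> ?\<Psi> (fsubst (repl 2 (cons_tm X (Var 1) (Var 0))) ?\<phi>)"
      by (simp add: subst_D numeral_eq_Suc)
  qed (use \<alpha> \<beta> in \<open>simp_all add: typing_iff_infer subst_D infer_D\<close>)
  from AllE[OF this, of s] s
  have "derives HA_omega \<Gamma> \<Phi> (All Nat (?eq (lift s) (Var 0) (lift \<alpha>) (lift \<beta>)))"
    by (simp add: typing_iff_infer subst_D)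
  from conv_AllE[OF this n] \<alpha> \<beta> s n show ?thesis by (simp add: subst_D infer_D)
qed

section \<open>Overwriting an initial segment\<close>

lemma conv_overwrite_app:
  assumes "infer \<Gamma> s = Some (Seq X)" "infer \<Gamma> \<alpha> = Some (Stream X)" "infer \<Gamma> n = Some Nat"
  shows "conv \<Gamma> \<Phi> X (overwrite X s \<alpha> \<cdot> n) (if_tm X (less n (len X s)) (entry X s n) (\<alpha> \<cdot> n))"
  using conv_beta3[of Nat "Stream X" "Seq X" \<Gamma>
      "if_tm X (less (Var 0) (len X (Var 2))) (entry X (Var 2) (Var 0)) (Var 1 \<cdot> Var 0)" X s \<alpha> n \<Phi>] assms
  by (simp add: overwrite_fun_def)

lemma conv_overwrite_conc:
  assumes "infer \<Gamma> s = Some (Seq X)" "infer \<Gamma> \<alpha> = Some (Stream X)"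
  shows "conv \<Gamma> \<Phi> (Stream X) (overwrite X s (conc X s \<alpha>)) (conc X s \<alpha>)"
proof (rule conv_ext)
  have "conv (Nat # \<Gamma>) (map flift \<Phi>) X (overwrite X (lift s) (conc X (lift s) (lift \<alpha>)) \<cdot> Var 0)
      (if_tm X (less (Var 0) (len X (lift s))) (entry X (lift s) (Var 0))
        (conc X (lift s) (lift \<alpha>) \<cdot> Var 0))"
    by (rule conv_overwrite_app) (use assms in simp_all)
  also have "conv (Nat # \<Gamma>) (map flift \<Phi>) X \<dots> (conc X (lift s) (lift \<alpha>) \<cdot> Var 0)"
    \<comment> \<open>Here \<open>\<beta>\<close> is the zero sequence that \<open>entry\<close>
      puts behind \<open>s\<close>, while \<open>\<alpha>\<close> is arbitrary.\<close>
    by (rule conv_if_less_len[where D = "\<lambda>s n \<alpha>. conc X s \<alpha> \<cdot> n"])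
      (use assms in \<open>simp_all add: conv_conc_cons_suc conv_fun[OF conv_conc_nil]\<close>)
  finally show "conv (Nat # \<Gamma>) (map flift \<Phi>) X (lift (overwrite X s (conc X s \<alpha>)) \<cdot> Var 0)
      (lift (conc X s \<alpha>) \<cdot> Var 0)"
    by simp
qed (use assms in simp_all)

lemma conv_zero_app:
  assumes "infer \<Gamma> n = Some \<sigma>"
  shows "conv \<Gamma> \<Phi> \<tau> (zero (\<sigma> \<rightarrow> \<tau>) \<cdot> n) (zero \<tau>)"
  using conv_beta[of \<sigma> \<Gamma> "zero \<tau>" \<tau> n \<Phi>] assms by (simp add: zero.simps)

lemma conv_overwrite_zero:
  assumes "infer \<Gamma> s = Some (Seq X)"
  shows "conv \<Gamma> \<Phi> (Stream X) (overwrite X s (zero (Stream X))) (conc X s (zero (Stream X)))"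
proof (rule conv_ext)
  have "conv (Nat # \<Gamma>) (map flift \<Phi>) X (overwrite X (lift s) (zero (Stream X)) \<cdot> Var 0)
      (if_tm X (less (Var 0) (len X (lift s))) (entry X (lift s) (Var 0)) (zero (Stream X) \<cdot> Var 0))"
    by (rule conv_overwrite_app) (use assms in simp_all)
  \<comment> \<open>Reducing the last branch to \<open>zero X\<close> makes it independent of the
    position, so the condition on \<open>D\<close> for \<open>cons_tm\<close> holds by
    reflexivity.\<close>
  also have "conv (Nat # \<Gamma>) (map flift \<Phi>) X \<dots>
      (if_tm X (less (Var 0) (len X (lift s))) (entry X (lift s) (Var 0)) (zero X))"
    by (rule conv_if[OF conv_refl conv_refl conv_zero_app]) (use assms in simp_all)
  also have "conv (Nat # \<Gamma>) (map flift \<Phi>) X \<dots> (entry X (lift s) (Var 0))"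
    by (rule conv_if_less_len[where D = "\<lambda>s n \<alpha>. zero X"])
      (use assms in \<open>simp_all add: conv_refl conv_sym[OF conv_zero_app]\<close>)
  finally show "conv (Nat # \<Gamma>) (map flift \<Phi>) X (lift (overwrite X s (zero (Stream X))) \<cdot> Var 0)
      (lift (conc X s (zero (Stream X))) \<cdot> Var 0)"
    by simp
qed (use assms in simp_all)

text \<open>Needed to move the prefix \<open>s\<close> into the two branches of the defining
  equation of \<open>EPS\<close>. The condition is an arbitrary term, so it is first treated as a
  boolean variable.\<close>

lemma conv_app_if:
  assumes b: "infer \<Gamma> b = Some Bool" and f: "infer \<Gamma> f = Some (X \<rightarrow> Y)"
    and t: "infer \<Gamma> t = Some X" and u: "infer \<Gamma> u = Some X"
  shows "conv \<Gamma> \<Phi> Y (f \<cdot> if_tm X b t u) (if_tm Y b (f \<cdot> t) (f \<cdot> u))"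
proof -
  have "conv \<Gamma> \<Phi> Y (f \<cdot> if_tm X tt t u) (if_tm Y tt (f \<cdot> t) (f \<cdot> u))"
    by (rule conv_trans[OF conv_arg[OF conv_if_tt] conv_sym[OF conv_if_tt]]) (use f t u in simp_all)
  moreover have "conv \<Gamma> \<Phi> Y (f \<cdot> if_tm X ff t u) (if_tm Y ff (f \<cdot> t) (f \<cdot> u))"
    by (rule conv_trans[OF conv_arg[OF conv_if_ff] conv_sym[OF conv_if_ff]]) (use f t u in simp_all)
  ultimately show ?thesis
    using conv_bool_cases[of \<Gamma> "lift f \<cdot> if_tm X (Var 0) (lift t) (lift u)" Y
        "if_tm Y (Var 0) (lift f \<cdot> lift t) (lift f \<cdot> lift u)" \<Phi> b] assms
    by simp
qed


section \<open>Bar recursion from the product of selection functions\<close>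

text \<open>The outcome function handed to \<open>EPS\<close>; under this name, substitution and
  lifting act on \<open>s\<close> only.\<close>

definition conc_with :: "ty \<Rightarrow> tm \<Rightarrow> tm" where
  "conc_with X s = Lam (Stream X) (conc X (lift s) (Var 0))"

lemma infer_conc_with [simp]:
  "infer \<Gamma> s = Some (Seq X) \<Longrightarrow> infer \<Gamma> (conc_with X s) = Some (Stream X \<rightarrow> Stream X)"
  by (simp add: conc_with_def)

lemma subst_conc_with [simp]: "subst \<theta> (conc_with X s) = conc_with X (subst \<theta> s)"
  by (simp add: conc_with_def)

lemma lift_conc_with [simp]: "lift (conc_with X s) = conc_with X (lift s)"
  using subst_conc_with[of "\<lambda>i. Var (Suc i)" X s] by simp

lemma conv_conc_with_app:
  assumes "infer \<Gamma> s = Some (Seq X)" "infer \<Gamma> \<alpha> = Some (Stream X)"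
  shows "conv \<Gamma> \<Phi> (Stream X) (conc_with X s \<cdot> \<alpha>) (conc X s \<alpha>)"
  using conv_beta[of "Stream X" \<Gamma> "conc X (lift s) (Var 0)" "Stream X" \<alpha> \<Phi>] assms
  by (simp add: conc_with_def)

text \<open>The invariant of the recursion: by associativity, shifting the outcome function amounts
  to extending \<open>s\<close>, so \<open>s\<close> alone determines it at every recursive
  call.\<close>

lemma conv_shift_conc_with:
  assumes "infer \<Gamma> s = Some (Seq X)" "infer \<Gamma> x = Some X"
  shows "conv \<Gamma> \<Phi> (Stream X \<rightarrow> Stream X) (shift X (conc_with X s) x)
    (conc_with X (append X s (single X x)))"
proof -
  have "conv (Stream X # \<Gamma>) (map flift \<Phi>) (Stream X)
      (conc_with X (lift s) \<cdot> conc X (single X (lift x)) (Var 0))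
      (conc X (append X (lift s) (single X (lift x))) (Var 0))"
    by (rule conv_trans[OF conv_conc_with_app conv_sym[OF conv_conc_append]]) (use assms in simp_all)
  from conv_Lam[OF this] show ?thesis
    by (simp add: shift_def conc_with_def[of X "append X s (single X x)"])
qed

definition sbr_of_eps :: "ty \<Rightarrow> tm" where  \<comment> \<open>\<open>\<lambda>E \<omega> \<epsilon> s. s * E \<omega> \<epsilon> s (\<lambda>\<alpha>. s * \<alpha>)\<close>\<close>
  "sbr_of_eps X = Lam (EPS_ty X (Stream X)) (Lam (Stream X \<rightarrow> Nat) (Lam (Seq X \<rightarrow> J (Stream X) X)
     (Lam (Seq X) (conc X (Var 0) (Var 3 \<cdot> Var 2 \<cdot> Var 1 \<cdot> Var 0 \<cdot> conc_with X (Var 0))))))"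

lemma infer_sbr_of_eps [simp]: "infer \<Gamma> (sbr_of_eps X) = Some (EPS_ty X (Stream X) \<rightarrow> SBR_ty X)"
  by (simp add: sbr_of_eps_def EPS_ty_def SBR_ty_def)

lemma subst_sbr_of_eps [simp]:
  "subst \<theta> (sbr_of_eps X) = sbr_of_eps X" "rename \<rho> (sbr_of_eps X) = sbr_of_eps X"
  by (simp_all add: sbr_of_eps_def conc_with_def)

lemma conv_sbr_of_eps:
  assumes "infer \<Gamma> E = Some (EPS_ty X (Stream X))" "infer \<Gamma> w = Some (Stream X \<rightarrow> Nat)"
    and "infer \<Gamma> e = Some (Seq X \<rightarrow> J (Stream X) X)" "infer \<Gamma> s = Some (Seq X)"
  shows "conv \<Gamma> \<Phi> (Stream X) (sbr_of_eps X \<cdot> E \<cdot> w \<cdot> e \<cdot> s)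
    (conc X s (E \<cdot> w \<cdot> e \<cdot> s \<cdot> conc_with X s))"
  using conv_beta4[of "Seq X" "Seq X \<rightarrow> J (Stream X) X" "Stream X \<rightarrow> Nat" "EPS_ty X (Stream X)" \<Gamma>
      "conc X (Var 0) (Var 3 \<cdot> Var 2 \<cdot> Var 1 \<cdot> Var 0 \<cdot> conc_with X (Var 0))" "Stream X" E w e s \<Phi>] assms
  by (simp add: sbr_of_eps_def EPS_ty_def)

text \<open>Translates a recursive call of \<open>EPS\<close>, whose outcome function is shifted,
  into one of bar recursion. The first form fits the sequence that is returned, the second the
  argument of the selection function.\<close>

lemma conv_eps_shift:
  assumes E: "infer \<Gamma> E = Some (EPS_ty X (Stream X))" and w: "infer \<Gamma> w = Some (Stream X \<rightarrow> Nat)"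
    and e: "infer \<Gamma> e = Some (Seq X \<rightarrow> J (Stream X) X)" and s: "infer \<Gamma> s = Some (Seq X)"
    and x: "infer \<Gamma> x = Some X"
  defines "t \<equiv> append X s (single X x)" and "q \<equiv> shift X (conc_with X s) x"
  shows "conv \<Gamma> \<Phi> (Stream X) (conc X t (E \<cdot> w \<cdot> e \<cdot> t \<cdot> q)) (sbr_of_eps X \<cdot> E \<cdot> w \<cdot> e \<cdot> t)"
    and "conv \<Gamma> \<Phi> (Stream X) (q \<cdot> (E \<cdot> w \<cdot> e \<cdot> t \<cdot> q)) (sbr_of_eps X \<cdot> E \<cdot> w \<cdot> e \<cdot> t)"
proof -
  have t: "infer \<Gamma> t = Some (Seq X)" and q: "infer \<Gamma> q = Some (Stream X \<rightarrow> Stream X)"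
    using s x by (simp_all add: t_def q_def)
  have shift: "conv \<Gamma> \<Phi> (Stream X \<rightarrow> Stream X) q (conc_with X t)"
    unfolding q_def t_def using s x by (rule conv_shift_conc_with)
  have "conv \<Gamma> \<Phi> (Stream X) (conc X t (E \<cdot> w \<cdot> e \<cdot> t \<cdot> q)) (conc X t (E \<cdot> w \<cdot> e \<cdot> t \<cdot> conc_with X t))"
    by (rule conv_arg[OF conv_arg[OF shift]]) (use E w e t in \<open>simp_all add: EPS_ty_def\<close>)
  also have "conv \<Gamma> \<Phi> (Stream X) \<dots> (sbr_of_eps X \<cdot> E \<cdot> w \<cdot> e \<cdot> t)"
    by (rule conv_sym[OF conv_sbr_of_eps[OF E w e t]])
  finally show *: "conv \<Gamma> \<Phi> (Stream X) (conc X t (E \<cdot> w \<cdot> e \<cdot> t \<cdot> q)) (sbr_of_eps X \<cdot> E \<cdot> w \<cdot> e \<cdot> t)" .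
  have "conv \<Gamma> \<Phi> (Stream X) (q \<cdot> (E \<cdot> w \<cdot> e \<cdot> t \<cdot> q)) (conc_with X t \<cdot> (E \<cdot> w \<cdot> e \<cdot> t \<cdot> q))"
    by (rule conv_fun[OF shift]) (use E w e t q in \<open>simp add: EPS_ty_def\<close>)
  also have "conv \<Gamma> \<Phi> (Stream X) \<dots> (conc X t (E \<cdot> w \<cdot> e \<cdot> t \<cdot> q))"
    by (rule conv_conc_with_app) (use E w e t q in \<open>simp_all add: EPS_ty_def\<close>)
  also note *
  finally show "conv \<Gamma> \<Phi> (Stream X) (q \<cdot> (E \<cdot> w \<cdot> e \<cdot> t \<cdot> q)) (sbr_of_eps X \<cdot> E \<cdot> w \<cdot> e \<cdot> t)" .
qed

text \<open>The defining equation of \<open>EPS\<close> enters through a single instance, with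
  outcome function \<open>conc_with X s\<close>; the rest compares the two right-hand sides part by
  part.\<close>

lemma conv_SBR_rhs:
  assumes E: "infer \<Gamma> E = Some (EPS_ty X (Stream X))" and w: "infer \<Gamma> w = Some (Stream X \<rightarrow> Nat)"
    and e: "infer \<Gamma> e = Some (Seq X \<rightarrow> J (Stream X) X)" and s: "infer \<Gamma> s = Some (Seq X)"
    and EPS: "conv \<Gamma> \<Phi> (Stream X) (E \<cdot> w \<cdot> e \<cdot> s \<cdot> conc_with X s) (EPS_rhs X E w e s (conc_with X s))"
  shows "conv \<Gamma> \<Phi> (Stream X) (sbr_of_eps X \<cdot> E \<cdot> w \<cdot> e \<cdot> s) (SBR_rhs X (sbr_of_eps X \<cdot> E) w e s)"
proof -
  let ?B = "sbr_of_eps X \<cdot> E" and ?Z = "zero (Stream X)" and ?q = "conc_with X s"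
  let ?snoc = "\<lambda>c. append X s (single X c)"
  let ?E = "\<lambda>c. E \<cdot> w \<cdot> e \<cdot> ?snoc c \<cdot> shift X ?q c"
  \<comment> \<open>Unprimed names are the parts of the right-hand side of \<open>EPS\<close>,
    primed names the corresponding parts for \<open>SBR\<close>.\<close>
  define p where "p = Lam X (let x = Var 0; qx = shift X (conc_with X (lift s)) x in
    qx \<cdot> (lift E \<cdot> lift w \<cdot> lift e \<cdot> append X (lift s) (single X x) \<cdot> qx))"
  define p' where "p' = Lam X (lift ?B \<cdot> lift w \<cdot> lift e \<cdot> append X (lift s) (single X (Var 0)))"
  define c where "c = e \<cdot> s \<cdot> p"
  define c' where "c' = e \<cdot> s \<cdot> p'"
  define b where "b = less (w \<cdot> (?q \<cdot> ?Z)) (len X s)"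
  define b' where "b' = less (w \<cdot> conc X s ?Z) (len X s)"
  have B: "infer \<Gamma> ?B = Some (SBR_ty X)"
    using E by simp
  have pp': "conv \<Gamma> \<Phi> (X \<rightarrow> Stream X) p p'"
    unfolding p_def p'_def Let_def rename.simps subst_sbr_of_eps
    \<comment> \<open>\<open>conv_eps_shift\<close> is applied below the binder, with the bound
      variable as the new entry.\<close>
    by (rule conv_Lam[OF conv_eps_shift(2)]) (use E w e s in simp_all)
  have cc': "conv \<Gamma> \<Phi> X c c'"
    unfolding c_def c'_def by (rule conv_arg[OF pp']) (use e s in simp)
  from conv_infer[OF this] have c: "infer \<Gamma> c = Some X" and c': "infer \<Gamma> c' = Some X" .
  have bb': "conv \<Gamma> \<Phi> Bool b b'"
    unfolding b_def b'_def
    by (rule conv_fun[OF conv_arg[OF conv_arg[OF conv_conc_with_app]]]) (use w s in simp_all)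
  from conv_infer(1)[OF this] have b: "infer \<Gamma> b = Some Bool" .
  have "conv \<Gamma> \<Phi> (Stream X) (?B \<cdot> w \<cdot> e \<cdot> s) (conc X s (EPS_rhs X E w e s ?q))"
    by (rule conv_trans[OF conv_sbr_of_eps conv_arg[OF EPS]]) (use E w e s in simp_all)
  also have "EPS_rhs X E w e s ?q = if_tm (Stream X) b ?Z (conc X (single X c) (?E c))"
    by (simp add: EPS_rhs_def Let_def b_def c_def p_def)
  \<comment> \<open>The dots stand for the case distinction just unfolded; prepending
    \<open>s\<close> is distributed over its branches.\<close>
  also have "conv \<Gamma> \<Phi> (Stream X) (conc X s \<dots>)
      (if_tm (Stream X) b (conc X s ?Z) (conc X s (conc X (single X c) (?E c))))"
    by (rule conv_app_if) (use E w e s b c in \<open>simp_all add: EPS_ty_def\<close>)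
  also have "conv \<Gamma> \<Phi> (Stream X) \<dots>
      (if_tm (Stream X) b' (overwrite X s ?Z) (overwrite X s (?B \<cdot> w \<cdot> e \<cdot> ?snoc c')))"
  proof (rule conv_if[OF bb' conv_sym[OF conv_overwrite_zero[OF s]]])
    let ?C = "conc X s (conc X (single X c) (?E c))"
    have C: "infer \<Gamma> (conc X (single X c) (?E c)) = Some (Stream X)"
      using E w e s c by (simp add: EPS_ty_def)
    have "conv \<Gamma> \<Phi> (Stream X) ?C (conc X (?snoc c) (?E c))"
      by (rule conv_sym[OF conv_conc_append]) (use E w e s c in \<open>simp_all add: EPS_ty_def\<close>)
    also have "conv \<Gamma> \<Phi> (Stream X) \<dots> (?B \<cdot> w \<cdot> e \<cdot> ?snoc c)"
      using E w e s c by (rule conv_eps_shift)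
    also have "conv \<Gamma> \<Phi> (Stream X) \<dots> (?B \<cdot> w \<cdot> e \<cdot> ?snoc c')"
      by (rule conv_arg[OF conv_arg[OF conv_fun[OF conv_arg[OF cc']]]])
        (use B w e s in \<open>simp_all add: SBR_ty_def\<close>)
    finally have CB: "conv \<Gamma> \<Phi> (Stream X) ?C (?B \<cdot> w \<cdot> e \<cdot> ?snoc c')" .
    \<comment> \<open>\<open>?C\<close> begins with \<open>s\<close>, so overwriting it with
      \<open>s\<close> changes nothing. This introduces the overwriting demanded by
      \<open>SBR\<close>, after which \<open>CB\<close> rewrites its argument.\<close>
    have "conv \<Gamma> \<Phi> (Stream X) ?C (overwrite X s ?C)"
      by (rule conv_sym[OF conv_overwrite_conc[OF s C]])
    also have "conv \<Gamma> \<Phi> (Stream X) \<dots> (overwrite X s (?B \<cdot> w \<cdot> e \<cdot> ?snoc c'))"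
      by (rule conv_arg[OF CB]) (use s in simp)
    finally show "conv \<Gamma> \<Phi> (Stream X) ?C (overwrite X s (?B \<cdot> w \<cdot> e \<cdot> ?snoc c'))" .
  qed
  also have "\<dots> = SBR_rhs X ?B w e s"
    by (simp add: SBR_rhs_def Let_def b'_def c'_def p'_def)
  finally show ?thesis .
qed

section \<open>Instantiating the defining equation of the product\<close>

lemma subst_EPS_rhs [simp]:
  "subst \<theta> (EPS_rhs X E l e s q)
    = EPS_rhs X (subst \<theta> E) (subst \<theta> l) (subst \<theta> e) (subst \<theta> s) (subst \<theta> q)"
  by (simp add: EPS_rhs_def Let_def)

lemma subst_SBR_rhs [simp]:
  "subst \<theta> (SBR_rhs X B w e s) = SBR_rhs X (subst \<theta> B) (subst \<theta> w) (subst \<theta> e) (subst \<theta> s)"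
  by (simp add: SBR_rhs_def Let_def)

lemma infer_EPS_rhs:
  assumes "infer \<Gamma> E = Some (EPS_ty X R)" "infer \<Gamma> l = Some (R \<rightarrow> Nat)"
    and "infer \<Gamma> e = Some (Seq X \<rightarrow> J R X)" "infer \<Gamma> s = Some (Seq X)"
    and "infer \<Gamma> q = Some (Stream X \<rightarrow> R)"
  shows "infer \<Gamma> (EPS_rhs X E l e s q) = Some (Stream X)"
  using assms by (simp add: EPS_rhs_def EPS_ty_def Let_def)

text \<open>Below the four quantifiers \<open>E\<close> is lifted four times. Each instantiation
  cancels one lifting of \<open>E\<close> and of the arguments already supplied, while a new
  argument is lifted past the quantifiers that remain.\<close>

lemma conv_EPS_eqn:
  defines "E' \<equiv> \<lambda>E. lift (lift (lift (lift E)))"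
  assumes "derives HA_omega \<Gamma> \<Phi>
      (All (R \<rightarrow> Nat) (All (Seq X \<rightarrow> J R X) (All (Seq X) (All (Stream X \<rightarrow> R)
        (Eq (Stream X) (E' E \<cdot> Var 3 \<cdot> Var 2 \<cdot> Var 1 \<cdot> Var 0)
          (EPS_rhs X (E' E) (Var 3) (Var 2) (Var 1) (Var 0)))))))"
    and E: "infer \<Gamma> E = Some (EPS_ty X R)" and l: "infer \<Gamma> l = Some (R \<rightarrow> Nat)"
    and e: "infer \<Gamma> e = Some (Seq X \<rightarrow> J R X)" and s: "infer \<Gamma> s = Some (Seq X)"
    and q: "infer \<Gamma> q = Some (Stream X \<rightarrow> R)"
  shows "conv \<Gamma> \<Phi> (Stream X) (E \<cdot> l \<cdot> e \<cdot> s \<cdot> q) (EPS_rhs X E l e s q)"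
proof -
  let ?l2 = "\<lambda>t. lift (lift t)" and ?l3 = "\<lambda>t. lift (lift (lift t))"
  from AllE[OF assms(2), of l] l
  have "derives HA_omega \<Gamma> \<Phi> (All (Seq X \<rightarrow> J R X) (All (Seq X) (All (Stream X \<rightarrow> R)
      (Eq (Stream X) (?l3 E \<cdot> ?l3 l \<cdot> Var 2 \<cdot> Var 1 \<cdot> Var 0)
        (EPS_rhs X (?l3 E) (?l3 l) (Var 2) (Var 1) (Var 0))))))"
    by (simp add: E'_def typing_iff_infer numeral_eq_Suc)
  from AllE[OF this, of e] e
  have "derives HA_omega \<Gamma> \<Phi> (All (Seq X) (All (Stream X \<rightarrow> R)
      (Eq (Stream X) (?l2 E \<cdot> ?l2 l \<cdot> ?l2 e \<cdot> Var 1 \<cdot> Var 0)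
        (EPS_rhs X (?l2 E) (?l2 l) (?l2 e) (Var 1) (Var 0)))))"
    by (simp add: typing_iff_infer)
  from AllE[OF this, of s] s
  have "derives HA_omega \<Gamma> \<Phi> (All (Stream X \<rightarrow> R)
      (Eq (Stream X) (lift E \<cdot> lift l \<cdot> lift e \<cdot> lift s \<cdot> Var 0)
        (EPS_rhs X (lift E) (lift l) (lift e) (lift s) (Var 0))))"
    by (simp add: typing_iff_infer)
  from conv_AllE[OF this q] E l e s show ?thesis
    by (simp add: EPS_ty_def infer_EPS_rhs[where R = R])
qed

theorem theorem3p18:
  shows "T_definable HA_omega EPS SBR"
  unfolding T_definable_def
proof (intro allI exI conjI)
  fix X :: ty
  let ?p = "(X, Stream X)"
  show "[] \<turnstile> sbr_of_eps X : spec_ty EPS ?p \<rightarrow> spec_ty SBR X"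
    by (simp add: EPS_def SBR_def typing_iff_infer)
  \<comment> \<open>The context below the three quantifiers of the \<open>SBR\<close> equation,
    innermost first: the given product has index 3, and its defining equation is lifted three
    times.\<close>
  let ?\<Gamma> = "[Seq X, Seq X \<rightarrow> J (Stream X) X, Stream X \<rightarrow> Nat, EPS_ty X (Stream X)]"
  let ?\<Phi> = "map flift (map flift (map flift [EPS_eqn X (Stream X)]))"
  have "conv ?\<Gamma> ?\<Phi> (Stream X) (Var 3 \<cdot> Var 2 \<cdot> Var 1 \<cdot> Var 0 \<cdot> conc_with X (Var 0))
      (EPS_rhs X (Var 3) (Var 2) (Var 1) (Var 0) (conc_with X (Var 0)))"
    \<comment> \<open>In the lifted assumption the product has index 7 below the four quantifiers,
      which is \<open>Var 3\<close> lifted four times, so \<open>Hyp\<close> applies.\<close>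
    by (rule conv_EPS_eqn[where R = "Stream X", OF Hyp])
      (simp_all add: EPS_eqn_def Let_def numeral_eq_Suc)
  from conv_SBR_rhs[OF _ _ _ _ this]
  have "derives HA_omega ?\<Gamma> ?\<Phi> (Eq (Stream X) (sbr_of_eps X \<cdot> Var 3 \<cdot> Var 2 \<cdot> Var 1 \<cdot> Var 0)
      (SBR_rhs X (sbr_of_eps X \<cdot> Var 3) (Var 2) (Var 1) (Var 0)))"
    by (simp add: conv_def)
  from AllI[OF AllI[OF AllI[OF this]]]
  show "derives HA_omega [spec_ty EPS ?p] [spec_eqn EPS ?p]
      (fsubst (repl 1 (sbr_of_eps X \<cdot> Var 0)) (spec_eqn SBR X))"
    by (simp add: EPS_def SBR_def SBR_eqn_def Let_def numeral_eq_Suc)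
qed

end
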